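(* There holds $$\inf_{0<t<1/e}\frac{M(t)}{(\log(e+1/t))^{1/2}} \ge \frac{1}{2\sqrt{2\pi}\,e^2},$$ where, for $t>0$, $$M(t) := \sup_{f \in H^1(\mathbb{R}^2) \setminus \{0\}}\frac{\|e^{t\Delta}f\|_{L^{\infty}(\mathbb{R}^2)}}{\|f\|_{H^1(\mathbb{R}^2)}}$$ and $\{e^{t\Delta}\}_{t\ge 0}$ is the heat semigroup on $\mathbb{R}^2$.
   Context: Functions are complex-valued. The Fourier transform and its inverse on $\mathbb{R}^2$ are normalized by $$(\mathcal{F}f)(\xi) := \frac{1}{2\pi}\int_{\mathbb{R}^2}e^{-ix\cdot\xi}f(x)\,dx, \qquad (\mathcal{F}^{-1}f)(x) := \frac{1}{2\pi}\int_{\mathbb{R}^2}e^{ix\cdot\xi}f(\xi)\,d\xi$$ for Schwartz functions $f$, and extended to unitary operators on $L^2(\mathbb{R}^2)$. The Sobolev space $H^1(\mathbb{R}^2)$ is the set of $f\in L^2(\mathbb{R}^2)$ with $$\|f\|_{H^1(\mathbb{R}^2)} := \left(\int_{\mathbb{R}^2}(1+|\xi|^2)|(\mathcal{F}f)(\xi)|^2\,d\xi\right)^{1/2}<\infty.$$ The heat semigroup is defined by $e^{t\Delta} := \mathcal{F}^{-1}e^{-t|\cdot|^2}\mathcal{F}$ for $t\ge 0$, i.e. $e^{t\Delta}f=\mathcal{F}^{-1}[e^{-t|\xi|^2}(\mathcal{F}f)(\xi)]$. *)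

theory Defs
  imports "HOL-Probability.Essential_Supremum"
begin

text \<open>
  Elements of the spaces below are represented by Borel functions on \<open>real ^ 2\<close>; two
  representatives denote the same element iff they agree almost everywhere.
\<close>

definition L2 :: "(real ^ 2 \<Rightarrow> complex) set" where
  "L2 = {f \<in> borel_measurable lborel. integrable lborel (\<lambda>x. (norm (f x))\<^sup>2)}"

text \<open>Convergence is expressed by the nonnegative integral, so that no integrability side
  condition is hidden in the value 0 of a divergent Bochner integral.\<close>

definition L2_tendsto ::
  "(nat \<Rightarrow> real ^ 2 \<Rightarrow> complex) \<Rightarrow> (real ^ 2 \<Rightarrow> complex) \<Rightarrow> bool" where
  "L2_tendsto \<phi> f \<longleftrightarrow>
     (\<lambda>n. \<integral>\<^sup>+ x. ennreal ((norm (\<phi> n x - f x))\<^sup>2) \<partial>lborel) \<longlonglongrightarrow> 0"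

definition partial_deriv ::
  "2 \<Rightarrow> (real ^ 2 \<Rightarrow> complex) \<Rightarrow> real ^ 2 \<Rightarrow> complex" where
  "partial_deriv i f x = frechet_derivative f (at x) (axis i 1)"

text \<open>Smoothness: every iterated partial derivative is differentiable everywhere (hence all of
  them are continuous).\<close>

definition schwartz :: "(real ^ 2 \<Rightarrow> complex) set" where
  "schwartz = {f. \<forall>is. (\<forall>x. foldr partial_deriv is f differentiable (at x)) \<and>
     (\<forall>N::nat. \<exists>C. \<forall>x. norm x ^ N * norm (foldr partial_deriv is f x) \<le> C)}"

definition fourier_integral :: "(real ^ 2 \<Rightarrow> complex) \<Rightarrow> real ^ 2 \<Rightarrow> complex" where
  "fourier_integral f \<xi> =
     1 / (2 * pi) * (LINT x|lborel. exp (- \<i> * complex_of_real (x \<bullet> \<xi>)) * f x)"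

definition inv_fourier_integral :: "(real ^ 2 \<Rightarrow> complex) \<Rightarrow> real ^ 2 \<Rightarrow> complex" where
  "inv_fourier_integral f x =
     1 / (2 * pi) * (LINT \<xi>|lborel. exp (\<i> * complex_of_real (x \<bullet> \<xi>)) * f \<xi>)"

text \<open>Extension by continuity from Schwartz functions. For the two transforms the limit exists
  for every element of \<^const>\<open>L2\<close> and does not depend, almost everywhere, on the approximating
  sequence, by the Plancherel theorem and density; the choice is only of a representative.\<close>

definition L2_extension ::
  "((real ^ 2 \<Rightarrow> complex) \<Rightarrow> real ^ 2 \<Rightarrow> complex) \<Rightarrow> (real ^ 2 \<Rightarrow> complex) \<Rightarrow> real ^ 2 \<Rightarrow> complex" where
  "L2_extension T f = (SOME g. g \<in> L2 \<and>
     (\<exists>\<phi>. (\<forall>n. \<phi> n \<in> schwartz) \<and> L2_tendsto \<phi> f \<and> L2_tendsto (\<lambda>n. T (\<phi> n)) g))"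

definition fourier :: "(real ^ 2 \<Rightarrow> complex) \<Rightarrow> real ^ 2 \<Rightarrow> complex" where
  "fourier = L2_extension fourier_integral"

definition inv_fourier :: "(real ^ 2 \<Rightarrow> complex) \<Rightarrow> real ^ 2 \<Rightarrow> complex" where
  "inv_fourier = L2_extension inv_fourier_integral"

definition H1 :: "(real ^ 2 \<Rightarrow> complex) set" where
  "H1 = {f \<in> L2. integrable lborel (\<lambda>\<xi>. (1 + (norm \<xi>)\<^sup>2) * (norm (fourier f \<xi>))\<^sup>2)}"

definition H1_norm :: "(real ^ 2 \<Rightarrow> complex) \<Rightarrow> real" where
  "H1_norm f = sqrt (LINT \<xi>|lborel. (1 + (norm \<xi>)\<^sup>2) * (norm (fourier f \<xi>))\<^sup>2)"

definition heat :: "real \<Rightarrow> (real ^ 2 \<Rightarrow> complex) \<Rightarrow> real ^ 2 \<Rightarrow> complex" where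
  "heat t f =
     inv_fourier (\<lambda>\<xi>. complex_of_real (exp (- t * (norm \<xi>)\<^sup>2)) * fourier f \<xi>)"

definition Linf_norm :: "(real ^ 2 \<Rightarrow> complex) \<Rightarrow> ennreal" where
  "Linf_norm g = esssup lborel (\<lambda>x. ennreal (norm (g x)))"

definition heat_M :: "real \<Rightarrow> ennreal" where
  "heat_M t = (SUP f \<in> {f \<in> H1. \<not> (AE x in lborel. f x = 0)}.
     Linf_norm (heat t f) / ennreal (H1_norm f))"

end

theory Submission
  imports Defs "HOL-Probability.Probability"
begin

text \<open>
  The supremum defining \<open>M(t)\<close> would be attained by the function with Fourier transform
  \<open>exp (- t \<bar>\<xi>\<bar>\<^sup>2) / (1 + \<bar>\<xi>\<bar>\<^sup>2)\<close>. Since the claimed constant leaves room, that function is replaced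
  by a dyadic sum of Gaussians, whose Fourier transform is \<open>\<Sum>k<n. \<sigma> k exp (- \<sigma> k \<bar>\<xi>\<bar>\<^sup>2)\<close> with
  \<open>\<sigma> k = t 2\<^sup>k \<le> 1\<close> and \<open>n\<close> about \<open>log\<^sub>2 (1/t)\<close>. Each scale contributes at least \<open>1/4\<close> to the value
  of the heat evolution at the origin, while distinct scales are almost orthogonal in \<open>H\<^sup>1\<close>, so
  that the squared norm is at most \<open>12 \<pi> n\<close>. The quotient is thus of order \<open>\<surd>n\<close>.

  The transforms on \<open>L\<^sup>2\<close> are only given as limits along some approximating sequence. They are
  identified with the integrals by the Plancherel inequality for integrable functions, obtained by
  inserting the factor \<open>exp (- a \<bar>\<xi>\<bar>\<^sup>2)\<close>, exchanging the integrals and letting \<open>a\<close> tend to \<open>0\<close>.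
\<close>

section \<open>Gaussian integrals\<close>

text \<open>This is the characteristic function of the standard normal law after a rescaling of the
  variable. \<open>has_bochner_integral\<close> carries integrability and value together, so both
  pass through products and sums later.\<close>

lemma has_bochner_integral_gaussian_fourier_real:
  fixes a \<xi> :: real
  assumes "a > 0"
  shows "has_bochner_integral lborel
    (\<lambda>x. exp (complex_of_real (- a * x\<^sup>2) + \<i> * complex_of_real (\<xi> * x)))
    (complex_of_real (sqrt (pi / a) * exp (- \<xi>\<^sup>2 / (4 * a))))"
proof -
  \<comment> \<open>With this \<open>c\<close> one has
    \<open>a * (c * x)\<^sup>2 = x\<^sup>2 / 2\<close>, the exponent of the standard normal
    density.\<close>
  define c where "c = 1 / sqrt (2 * a)"
  have c: "c > 0" "c\<^sup>2 = 1 / (2 * a)" using assms by (auto simp: c_def power_divide)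
  define \<tau> where "\<tau> = c * \<xi>"
  let ?f = "\<lambda>x. std_normal_density x *\<^sub>R exp (\<i> * complex_of_real (\<tau> * x))"
  have "integrable lborel ?f"
    by (rule Bochner_Integration.integrable_bound[OF integrable_normal_density[of 1 0]])
       (auto simp: norm_mult simp flip: of_real_mult)
  moreover have "integral\<^sup>L lborel ?f = complex_of_real (exp (- (\<tau>\<^sup>2) / 2))"
    using char_std_normal_distribution[THEN fun_cong, of \<tau>]
    unfolding char_def by (subst (asm) integral_density) (auto)
  ultimately have "has_bochner_integral lborel ?f (complex_of_real (exp (- (\<tau>\<^sup>2) / 2)))"
    by (simp add: has_bochner_integral_iff)
  from has_bochner_integral_mult_right[OF this, of "complex_of_real (sqrt (2 * pi))"]
  have *: "has_bochner_integral lborel (\<lambda>x. complex_of_real (sqrt (2 * pi)) * ?f x)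
    (complex_of_real (sqrt (2 * pi)) * complex_of_real (exp (- (\<tau>\<^sup>2) / 2)))" by blast
  \<comment> \<open>The summand \<open>0\<close> gives the argument the shape of the affine
    substitution rule used at the end, with shift \<open>0\<close> and Jacobian
    \<open>\<bar>c\<bar>\<close>.\<close>
  have eq: "complex_of_real (sqrt (2 * pi)) * ?f x
     = exp (complex_of_real (- a * (0 + c * x)\<^sup>2) + \<i> * complex_of_real (\<xi> * (0 + c * x)))" for x
  proof -
    have arg: "- a * (0 + c * x)\<^sup>2 = - x\<^sup>2 / 2" "\<xi> * (0 + c * x) = \<tau> * x"
      using c assms by (simp_all add: power_mult_distrib \<tau>_def)
    have "sqrt (2 * pi) * std_normal_density x = exp (- x\<^sup>2 / 2)"
      by (simp add: std_normal_density_def)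
    then have "complex_of_real (sqrt (2 * pi)) * ?f x
      = complex_of_real (exp (- x\<^sup>2 / 2)) * exp (\<i> * complex_of_real (\<tau> * x))"
      by (simp only: scaleR_conv_of_real mult.assoc[symmetric] of_real_mult[symmetric])
    then show ?thesis by (simp only: arg exp_add exp_of_real)
  qed
  have val: "(complex_of_real (sqrt (2 * pi)) * complex_of_real (exp (- (\<tau>\<^sup>2) / 2)))
     = complex_of_real (sqrt (pi / a) * exp (- \<xi>\<^sup>2 / (4 * a))) /\<^sub>R \<bar>c\<bar>"
  proof -
    have 1: "- (\<tau>\<^sup>2) / 2 = - \<xi>\<^sup>2 / (4 * a)" by (simp add: \<tau>_def power_mult_distrib c)
    have "sqrt (pi / a) * sqrt (2 * a) = sqrt (pi / a * (2 * a))" by (rule real_sqrt_mult[symmetric])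
    also have "pi / a * (2 * a) = 2 * pi" using assms by simp
    finally have 2: "sqrt (2 * pi) = inverse \<bar>c\<bar> * sqrt (pi / a)" using c(1) by (simp add: c_def mult.commute)
    show ?thesis
      unfolding 1 2 by (simp only: scaleR_conv_of_real of_real_mult mult.assoc)
  qed
  show ?thesis
    using * unfolding eq val
    by (subst lborel_has_bochner_integral_real_affine_iff[where c = c and t = 0]) (use c in auto)
qed

text \<open>\<open>lborel\<close> is the image of the product of one-dimensional Lebesgue measures
  under the map assembling a vector from its coordinates, so Fubini for finite products applies. It
  serves both for Gaussians and for the integrable majorant of Schwartz functions.\<close>

lemma has_bochner_integral_lborel_prod:
  fixes f :: "'a::euclidean_space \<Rightarrow> real \<Rightarrow> complex"
  assumes "\<And>b. b \<in> Basis \<Longrightarrow> has_bochner_integral lborel (f b) (I b)"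
  shows "has_bochner_integral lborel (\<lambda>x. \<Prod>b\<in>Basis. f b (x \<bullet> b)) (\<Prod>b\<in>Basis. I b)"
proof -
  interpret product_sigma_finite "\<lambda>_::'a. lborel :: real measure" ..
  have m[measurable]: "f b \<in> borel_measurable borel" if "b \<in> Basis" for b
    using assms[OF that] by (auto simp: has_bochner_integral_iff dest: borel_measurable_integrable)
  have meas: "(\<lambda>f. \<Sum>b\<in>Basis. f b *\<^sub>R b) \<in> measurable (\<Pi>\<^sub>M b\<in>(Basis::'a set). lborel) borel"
    by measurable
  have "has_bochner_integral (\<Pi>\<^sub>M b\<in>(Basis::'a set). lborel) (\<lambda>x. \<Prod>b\<in>Basis. f b (x b)) (\<Prod>b\<in>Basis. I b)"
    using product_integrable_prod[of Basis f] product_integral_prod[of Basis f] assms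
    by (auto simp: has_bochner_integral_iff)
  moreover have "(\<lambda>x. \<Prod>b\<in>Basis. f b ((\<Sum>b\<in>Basis. x b *\<^sub>R b) \<bullet> b)) = (\<lambda>x. \<Prod>b\<in>Basis. f b (x b))"
    by (auto intro!: prod.cong simp: inner_sum_left inner_Basis if_distrib sum.delta cong: if_cong)
  moreover have "(\<lambda>x. \<Prod>b\<in>Basis. f b (x \<bullet> b)) \<in> borel_measurable borel"
    by (intro borel_measurable_prod) (rule measurable_compose[OF _ m], auto)
  ultimately show ?thesis
    unfolding lborel_eq[where 'a='a] using meas
    by (auto simp: has_bochner_integral_iff integrable_distr_eq integral_distr)
qed

lemma has_bochner_integral_gaussian_fourier:
  fixes \<xi> :: "'a::euclidean_space"
  assumes "a > 0"
  shows "has_bochner_integral lborel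
    (\<lambda>x. exp (complex_of_real (- a * (norm x)\<^sup>2) + \<i> * complex_of_real (x \<bullet> \<xi>)))
    (complex_of_real (sqrt (pi / a) ^ DIM('a) * exp (- (norm \<xi>)\<^sup>2 / (4 * a))))"
proof -
  have n: "(norm x)\<^sup>2 = (\<Sum>b\<in>Basis. (x \<bullet> b)\<^sup>2)" for x :: 'a
    by (subst power2_norm_eq_inner, subst euclidean_inner) (simp add: power2_eq_square)
  have 1: "(\<Prod>b\<in>Basis. exp (complex_of_real (- a * (x \<bullet> b)\<^sup>2) + \<i> * complex_of_real (\<xi> \<bullet> b * (x \<bullet> b))))
     = exp (complex_of_real (- a * (norm x)\<^sup>2) + \<i> * complex_of_real (x \<bullet> \<xi>))" for x
  proof -
    have "complex_of_real (- a * (norm x)\<^sup>2) = (\<Sum>b\<in>Basis. complex_of_real (- a * (x \<bullet> b)\<^sup>2))"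
      unfolding n sum_distrib_left by (rule of_real_sum)
    moreover have "\<i> * complex_of_real (x \<bullet> \<xi>) = (\<Sum>b\<in>Basis. \<i> * complex_of_real (\<xi> \<bullet> b * (x \<bullet> b)))"
      unfolding euclidean_inner[of x \<xi>] of_real_sum sum_distrib_left by (simp only: mult.commute)
    ultimately show ?thesis by (simp only: sum.distrib exp_sum[symmetric] finite_Basis)
  qed
  have 2: "(\<Prod>b\<in>Basis. complex_of_real (sqrt (pi / a) * exp (- (\<xi> \<bullet> b)\<^sup>2 / (4 * a))))
     = complex_of_real (sqrt (pi / a) ^ DIM('a) * exp (- (norm \<xi>)\<^sup>2 / (4 * a)))"
    unfolding n of_real_prod[symmetric]
    by (simp only: prod.distrib exp_sum[symmetric] finite_Basis prod_constant sum_negf[symmetric] sum_divide_distrib)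
  show ?thesis
    unfolding 1[symmetric] 2[symmetric]
    by (rule has_bochner_integral_lborel_prod has_bochner_integral_gaussian_fourier_real assms)+
qed

section \<open>Gaussians are Schwartz functions\<close>

definition gauss :: "real \<Rightarrow> real ^ 2 \<Rightarrow> complex" where
  "gauss a x = complex_of_real (exp (- a * (norm x)\<^sup>2))"

text \<open>Membership in \<open>schwartz\<close> speaks of all iterated partial derivatives, so a
  class closed under \<open>partial_deriv\<close> is called for. These are the sums of polynomials
  times Gaussians of positive parameter; the generators are chosen so that each property is a short
  induction.\<close>

inductive_set poly_gauss :: "(real ^ 2 \<Rightarrow> complex) set" where
  gauss: "a > 0 \<Longrightarrow> gauss a \<in> poly_gauss"
| nth: "f \<in> poly_gauss \<Longrightarrow> (\<lambda>x. complex_of_real (x $ i) * f x) \<in> poly_gauss"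
| cmul: "f \<in> poly_gauss \<Longrightarrow> (\<lambda>x. c * f x) \<in> poly_gauss"
| add: "f \<in> poly_gauss \<Longrightarrow> g \<in> poly_gauss \<Longrightarrow> (\<lambda>x. f x + g x) \<in> poly_gauss"

lemma has_derivative_gauss:
  "(gauss a has_derivative (\<lambda>h. complex_of_real (- 2 * a * (x \<bullet> h)) * gauss a x)) (at x)"
  unfolding gauss_def power2_norm_eq_inner
  by (auto intro!: derivative_eq_intros has_derivative_of_real simp: inner_commute algebra_simps)

lemma partial_deriv_eq: "(f has_derivative f') (at x) \<Longrightarrow> partial_deriv i f x = f' (axis i 1)"
  by (simp add: partial_deriv_def frechet_derivative_at[symmetric])

lemma differentiable_partial_deriv:
   "f differentiable (at x) \<Longrightarrow> \<exists>f'. (f has_derivative f') (at x) \<and> (\<forall>i. partial_deriv i f x = f' (axis i 1))"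
  using partial_deriv_eq by (auto simp: differentiable_def)

text \<open>The two claims go through the induction together: the product and sum rules need the
  differentiability of the constituents before their partial derivatives can be computed.\<close>

lemma poly_gauss_deriv:
  assumes "f \<in> poly_gauss"
  shows "(\<forall>x. f differentiable (at x)) \<and> (\<forall>i. partial_deriv i f \<in> poly_gauss)"
  using assms
proof induction
  case (gauss a)
  have "partial_deriv i (gauss a) = (\<lambda>x. complex_of_real (- 2 * a) * (complex_of_real (x $ i) * gauss a x))" for i
    by (rule ext) (simp add: partial_deriv_eq[OF has_derivative_gauss] inner_axis)
  note eq = this
  have "partial_deriv i (gauss a) \<in> poly_gauss" for i
    unfolding eq by (rule poly_gauss.cmul[OF poly_gauss.nth[OF poly_gauss.gauss[OF gauss]]])
  then show ?case using has_derivative_gauss[of a] by (auto simp: differentiable_def)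
next
  case (nth f j)
  { fix x
    obtain f' where f': "(f has_derivative f') (at x)" "\<And>i. partial_deriv i f x = f' (axis i 1)"
      using nth.IH differentiable_partial_deriv[of f x] by blast
    have d: "((\<lambda>x. complex_of_real (x $ j) * f x) has_derivative
      (\<lambda>h. complex_of_real (x $ j) * f' h + complex_of_real (h $ j) * f x)) (at x)"
      by (auto intro!: derivative_eq_intros f' has_derivative_of_real bounded_linear.has_derivative[OF bounded_linear_vec_nth])
    note differentiableI[OF d] partial_deriv_eq[OF d, folded f'(2)]
  } note * = this
  have "partial_deriv i (\<lambda>x. complex_of_real (x $ j) * f x)
    = (\<lambda>x. complex_of_real (x $ j) * partial_deriv i f x + complex_of_real (axis i 1 $ j) * f x)" for i
    by (rule ext) (rule *(2))
  note eq = this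
  have D: "partial_deriv i f \<in> poly_gauss" for i
    using nth.IH by simp
  have "partial_deriv i (\<lambda>x. complex_of_real (x $ j) * f x) \<in> poly_gauss" for i
    unfolding eq by (rule poly_gauss.add[OF poly_gauss.nth[OF D] poly_gauss.cmul[OF nth.hyps]])
  then show ?case using *(1) by simp
next
  case (cmul f c)
  { fix x
    obtain f' where f': "(f has_derivative f') (at x)" "\<And>i. partial_deriv i f x = f' (axis i 1)"
      using cmul.IH differentiable_partial_deriv[of f x] by blast
    have d: "((\<lambda>x. c * f x) has_derivative (\<lambda>h. c * f' h)) (at x)"
      by (auto intro!: derivative_eq_intros f')
    note differentiableI[OF d] partial_deriv_eq[OF d, folded f'(2)]
  } note * = this
  have "partial_deriv i (\<lambda>x. c * f x) = (\<lambda>x. c * partial_deriv i f x)" for i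
    by (rule ext) (rule *(2))
  note eq = this
  have D: "partial_deriv i f \<in> poly_gauss" for i
    using cmul.IH by simp
  have "partial_deriv i (\<lambda>x. c * f x) \<in> poly_gauss" for i
    unfolding eq by (rule poly_gauss.cmul[OF D])
  then show ?case using *(1) by simp
next
  case (add f g)
  { fix x
    obtain f' where f': "(f has_derivative f') (at x)" "\<And>i. partial_deriv i f x = f' (axis i 1)"
      using add.IH(1) differentiable_partial_deriv[of f x] by blast
    obtain g' where g': "(g has_derivative g') (at x)" "\<And>i. partial_deriv i g x = g' (axis i 1)"
      using add.IH(2) differentiable_partial_deriv[of g x] by blast
    have d: "((\<lambda>x. f x + g x) has_derivative (\<lambda>h. f' h + g' h)) (at x)"
      by (auto intro!: derivative_eq_intros f' g')
    note differentiableI[OF d] partial_deriv_eq[OF d, folded f'(2) g'(2)]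
  } note * = this
  have "partial_deriv i (\<lambda>x. f x + g x) = (\<lambda>x. partial_deriv i f x + partial_deriv i g x)" for i
    by (rule ext) (rule *(2))
  note eq = this
  have D: "partial_deriv i f \<in> poly_gauss" for i
    using add.IH(1) by simp
  have E: "partial_deriv i g \<in> poly_gauss" for i
    using add.IH(2) by simp
  have "partial_deriv i (\<lambda>x. f x + g x) \<in> poly_gauss" for i
    unfolding eq by (rule poly_gauss.add[OF D E])
  then show ?case using *(1) by simp
qed

text \<open>A single term of the exponential series, \<open>y ^ N / fact N \<le> exp y\<close> with
  \<open>y = a * r\<^sup>2\<close>, controls even powers of \<open>r\<close>. The power
  \<open>r ^ N\<close> is reduced to these by \<open>r ^ N \<le> 1 + (r\<^sup>2) ^ N\<close>, which
  follows from \<open>(r ^ N - 1)\<^sup>2 \<ge> 0\<close>.\<close>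

lemma power_mult_exp_bounded:
  fixes a :: real
  assumes "a > 0"
  shows "\<exists>C. \<forall>r\<ge>0. r ^ N * exp (- a * r\<^sup>2) \<le> C"
proof (intro exI allI impI)
  fix r :: real assume r: "r \<ge> 0"
  have "(\<Sum>n\<in>{N}. (a * r\<^sup>2) ^ n /\<^sub>R fact n) \<le> exp (a * r\<^sup>2)"
    unfolding exp_def by (rule sum_le_suminf) (use summable_exp_generic[of "a * r\<^sup>2"] assms in auto)
  then have e: "(r\<^sup>2) ^ N * exp (- a * r\<^sup>2) \<le> fact N / a ^ N"
    using assms by (simp add: field_simps exp_minus power_mult_distrib)
  have "r ^ N \<le> 1 + (r\<^sup>2) ^ N"
    using zero_le_power2[of "r ^ N - 1"] zero_le_power[OF r, of N]
    by (simp add: power2_eq_square algebra_simps flip: power_mult_distrib)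
  then have "r ^ N * exp (- a * r\<^sup>2) \<le> 1 * exp (- a * r\<^sup>2) + (r\<^sup>2) ^ N * exp (- a * r\<^sup>2)"
    by (subst distrib_right[symmetric]) (rule mult_right_mono, auto)
  show "r ^ N * exp (- a * r\<^sup>2) \<le> 1 + fact N / a ^ N"
  proof -
    have "exp (- a * r\<^sup>2) \<le> 1" using assms by simp
    then show ?thesis using e \<open>r ^ N * _ \<le> _\<close> by linarith
  qed
qed

lemma poly_gauss_decay:
  assumes "f \<in> poly_gauss"
  shows "\<exists>C. \<forall>x. norm x ^ N * norm (f x) \<le> C"
  using assms
proof (induction arbitrary: N)
  case (gauss a)
  obtain C where "\<And>r. r \<ge> 0 \<Longrightarrow> r ^ N * exp (- a * r\<^sup>2) \<le> C"
    using power_mult_exp_bounded[OF gauss] by blast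
  then have "norm x ^ N * norm (gauss a x) \<le> C" for x :: "real ^ 2"
    unfolding gauss_def norm_of_real by simp
  then show ?case by blast
next
  case (nth f i)
  \<comment> \<open>A coordinate factor costs one power of the norm, hence the induction hypothesis
    is taken at \<open>Suc N\<close>; this is why \<open>N\<close> is generalized.\<close>
  obtain C where C: "norm x ^ (Suc N) * norm (f x) \<le> C" for x using nth.IH by blast
  have "norm x ^ N * norm (complex_of_real (x $ i) * f x) \<le> norm x ^ (Suc N) * norm (f x)" for x
    using mult_right_mono[OF component_le_norm_cart[of x i], of "norm x ^ N * norm (f x)"]
    by (simp add: norm_mult mult_ac)
  then show ?case using order_trans[OF _ C] by blast
next
  case (cmul f c)
  obtain C where C: "norm x ^ N * norm (f x) \<le> C" for x using cmul.IH by blast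
  have "norm x ^ N * norm (c * f x) \<le> norm c * C" for x
    using mult_left_mono[OF C[of x], of "norm c"] by (simp add: norm_mult mult_ac)
  then show ?case by blast
next
  case (add f g)
  obtain C where C: "norm x ^ N * norm (f x) \<le> C" for x using add.IH(1) by blast
  obtain D where D: "norm x ^ N * norm (g x) \<le> D" for x using add.IH(2) by blast
  have "norm x ^ N * norm (f x + g x) \<le> C + D" for x
    using mult_left_mono[OF norm_triangle_ineq[of "f x" "g x"], of "norm x ^ N"] C[of x] D[of x]
    by (simp add: distrib_left)
  then show ?case by blast
qed

lemma poly_gauss_schwartz: "poly_gauss \<subseteq> schwartz"
proof
  fix f assume f: "f \<in> poly_gauss"
  have "foldr partial_deriv is f \<in> poly_gauss" for "is"
    by (induction "is") (use f poly_gauss_deriv in auto)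
  then show "f \<in> schwartz" unfolding schwartz_def
    using poly_gauss_deriv poly_gauss_decay by blast
qed

lemma gauss_sum_schwartz:
  assumes "finite A" "\<And>k. k \<in> A \<Longrightarrow> a k > 0"
  shows "(\<lambda>x. \<Sum>k\<in>A. c k * gauss (a k) x) \<in> schwartz"
proof -
  have "(\<lambda>x. \<Sum>k\<in>A. c k * gauss (a k) x) \<in> poly_gauss"
    using assms
  proof (induction rule: finite_induct)
    case empty
    \<comment> \<open>The zero function enters the class as \<open>0\<close> times a
      Gaussian.\<close>
    then show ?case using poly_gauss.cmul[OF poly_gauss.gauss[of 1], of 0] by simp
  next
    case (insert k A)
    then show ?case by (auto intro!: poly_gauss.intros)
  qed
  then show ?thesis using poly_gauss_schwartz by blast
qed

section \<open>The Plancherel inequality\<close>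

lemma integrable_lborel_tensor:
  fixes u :: "'a::euclidean_space \<Rightarrow> 'c::{real_normed_field,banach,second_countable_topology}"
    and v :: "'b::euclidean_space \<Rightarrow> 'c"
  assumes "integrable lborel u" "integrable lborel v"
  shows "integrable (lborel \<Otimes>\<^sub>M lborel) (\<lambda>z. u (fst z) * v (snd z))"
proof (rule lborel_pair.Fubini_integrable)
  show "(\<lambda>z. u (fst z) * v (snd z)) \<in> borel_measurable (lborel \<Otimes>\<^sub>M lborel)"
    using assms[THEN borel_measurable_integrable] by measurable
qed (use assms in \<open>auto simp: norm_mult\<close>)

lemma has_bochner_integral_gaussian:
  assumes "a > 0"
  shows "has_bochner_integral lborel (\<lambda>x :: 'a::euclidean_space. exp (- a * (norm x)\<^sup>2))
    (sqrt (pi / a) ^ DIM('a))"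
proof -
  have "has_bochner_integral lborel (\<lambda>x :: 'a. complex_of_real (exp (- a * (norm x)\<^sup>2)))
    (complex_of_real (sqrt (pi / a) ^ DIM('a)))"
    using has_bochner_integral_gaussian_fourier[OF assms, of "0::'a"] by (simp add: exp_of_real del: of_real_mult of_real_minus of_real_power mult_minus_left)
  from has_bochner_integral_Re[OF this] show ?thesis by (simp only: Re_complex_of_real)
qed

text \<open>The parameter \<open>s\<close> lets one argument treat the Fourier transform and its
  inverse. The factor \<open>1 / (2 * pi)\<close> is left out, so that the Plancherel bound can be
  stated in any dimension.\<close>

definition osc_integral :: "real \<Rightarrow> ('a::euclidean_space \<Rightarrow> complex) \<Rightarrow> 'a \<Rightarrow> complex" where
  "osc_integral s f \<xi> = (LINT x|lborel. exp (\<i> * complex_of_real (s * (x \<bullet> \<xi>))) * f x)"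

lemma integrable_osc:
  assumes "integrable lborel f"
  shows "integrable lborel (\<lambda>x::'a::euclidean_space. exp (\<i> * complex_of_real (s * (x \<bullet> \<xi>))) * f x)"
  by (rule Bochner_Integration.integrable_bound[OF assms])
     (use borel_measurable_integrable[OF assms] in \<open>auto simp: norm_mult\<close>)

lemma borel_measurable_osc_integral:
  assumes [measurable]: "f \<in> borel_measurable borel"
  shows "osc_integral s f \<in> borel_measurable (borel :: 'a::euclidean_space measure)"
proof -
  have "(\<lambda>\<xi>::'a. LINT x|lborel. exp (\<i> * complex_of_real (s * (x \<bullet> \<xi>))) * f x) \<in> borel_measurable lborel"
    by (rule lborel.borel_measurable_lebesgue_integral) measurable
  then show ?thesis by (simp add: osc_integral_def[abs_def])
qed

text \<open>The square is the integral times its conjugate, read as one integral over pairs. The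
  phase then depends on the difference of the two points only, which prepares integration over the
  frequency first.\<close>

lemma norm_osc_integral_sq:
  fixes f :: "'a::euclidean_space \<Rightarrow> complex"
  assumes f: "integrable lborel f"
  shows "complex_of_real ((norm (osc_integral s f \<xi>))\<^sup>2) =
    (LINT z|(lborel \<Otimes>\<^sub>M lborel). exp (\<i> * complex_of_real (\<xi> \<bullet> (s *\<^sub>R (fst z - snd z)))) * (f (fst z) * cnj (f (snd z))))"
proof -
  let ?e = "\<lambda>x. exp (\<i> * complex_of_real (s * (x \<bullet> \<xi>))) * f x"
  have i: "integrable lborel ?e" using f by (rule integrable_osc)
  have ic: "integrable lborel (\<lambda>x. cnj (?e x))"
    using i by (rule integrable_bounded_linear[OF bounded_linear_cnj])
  have "complex_of_real ((norm (osc_integral s f \<xi>))\<^sup>2) = integral\<^sup>L lborel ?e * cnj (integral\<^sup>L lborel ?e)"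
    unfolding osc_integral_def by (rule complex_norm_square)
  also have "\<dots> = (LINT x|lborel. LINT y|lborel. ?e x * cnj (?e y))"
    by (simp only: integral_mult_left_zero integral_mult_right_zero integral_bounded_linear[OF bounded_linear_cnj i])
  also have "\<dots> = (LINT z|(lborel \<Otimes>\<^sub>M lborel). ?e (fst z) * cnj (?e (snd z)))"
    using lborel_pair.integral_fst'[OF integrable_lborel_tensor[OF i ic]] by simp
  also have "(\<lambda>z. ?e (fst z) * cnj (?e (snd z))) = (\<lambda>z. exp (\<i> * complex_of_real (\<xi> \<bullet> (s *\<^sub>R (fst z - snd z)))) * (f (fst z) * cnj (f (snd z))))"
    by (rule ext) (simp add: exp_cnj exp_diff exp_minus inner_diff_right inner_commute[of \<xi>] algebra_simps divide_inverse)
  finally show ?thesis .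
qed

lemma nn_integral_lborel_translate:
  fixes f :: "'a::euclidean_space \<Rightarrow> ennreal"
  assumes [measurable]: "f \<in> borel_measurable borel"
  shows "(\<integral>\<^sup>+y. f (y - x) \<partial>lborel) = (\<integral>\<^sup>+y. f y \<partial>lborel)"
proof -
  have "(\<integral>\<^sup>+y. f y \<partial>lborel) = (\<integral>\<^sup>+y. f y \<partial>(distr lborel borel ((+) (- x))))"
    by (simp add: lborel_distr_plus)
  also have "\<dots> = (\<integral>\<^sup>+y. f (y - x) \<partial>lborel)"
    by (subst nn_integral_distr) auto
  finally show ?thesis by simp
qed

text \<open>A Schur test: \<open>2 * p * q \<le> p\<^sup>2 + q\<^sup>2\<close> splits the form into
  two integrals, each equal to the right-hand side by Tonelli, translation invariance and the
  symmetry of \<open>K\<close>.\<close>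

lemma nn_integral_convolution_form_le:
  fixes f :: "'a::euclidean_space \<Rightarrow> complex" and K :: "'a \<Rightarrow> real"
  assumes [measurable]: "f \<in> borel_measurable borel" "K \<in> borel_measurable borel"
    and K: "\<And>w. K w \<ge> 0" "\<And>w. K (- w) = K w"
  shows "(\<integral>\<^sup>+z. ennreal (norm (f (fst z)) * norm (f (snd z)) * K (fst z - snd z)) \<partial>(lborel \<Otimes>\<^sub>M lborel))
    \<le> (\<integral>\<^sup>+w. K w \<partial>lborel) * (\<integral>\<^sup>+x. ennreal ((norm (f x))\<^sup>2) \<partial>lborel)"
proof -
  let ?h = "\<lambda>x y. ennreal ((norm (f x))\<^sup>2) * ennreal (K (x - y))"
  let ?R = "(\<integral>\<^sup>+w. K w \<partial>lborel) * (\<integral>\<^sup>+x. ennreal ((norm (f x))\<^sup>2) \<partial>lborel)"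
  have Kc: "K (x - y) = K (y - x)" for x y using K(2)[of "x - y"] by simp
  have m1: "(\<lambda>z. ?h (fst z) (snd z)) \<in> borel_measurable (lborel \<Otimes>\<^sub>M lborel)"
    by measurable
  have m2: "(\<lambda>z. ?h (snd z) (fst z)) \<in> borel_measurable (lborel \<Otimes>\<^sub>M lborel)"
    by measurable
  have 1: "(\<integral>\<^sup>+z. ?h (fst z) (snd z) \<partial>(lborel \<Otimes>\<^sub>M lborel)) = ?R"
  proof -
    have "(\<integral>\<^sup>+z. ?h (fst z) (snd z) \<partial>(lborel \<Otimes>\<^sub>M lborel)) = (\<integral>\<^sup>+x. \<integral>\<^sup>+y. ?h x y \<partial>lborel \<partial>lborel)"
      using lborel.nn_integral_fst[OF m1] by simp
    also have "\<dots> = (\<integral>\<^sup>+x. ennreal ((norm (f x))\<^sup>2) * (\<integral>\<^sup>+w. K w \<partial>lborel) \<partial>lborel)"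
      using nn_integral_lborel_translate[of "\<lambda>w. ennreal (K w)"]
      by (intro nn_integral_cong) (subst nn_integral_cmult, auto simp: Kc)
    also have "\<dots> = ?R" by (subst nn_integral_multc) (auto simp: mult.commute)
    finally show ?thesis .
  qed
  have 2: "(\<integral>\<^sup>+z. ?h (snd z) (fst z) \<partial>(lborel \<Otimes>\<^sub>M lborel)) = ?R"
    using lborel_pair.nn_integral_snd[of "\<lambda>z. ?h (snd z) (fst z)"] lborel.nn_integral_fst[OF m1] m2 1
    by (simp add: case_prod_beta')
  have "(\<integral>\<^sup>+z. ennreal (norm (f (fst z)) * norm (f (snd z)) * K (fst z - snd z)) \<partial>(lborel \<Otimes>\<^sub>M lborel))
     \<le> (\<integral>\<^sup>+z. ennreal (1/2) * (?h (fst z) (snd z) + ?h (snd z) (fst z)) \<partial>(lborel \<Otimes>\<^sub>M lborel))"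
  proof (intro nn_integral_mono)
    fix z :: "'a \<times> 'a"
    define p q k where "p = norm (f (fst z))" and "q = norm (f (snd z))" and "k = K (fst z - snd z)"
    have "p * q * k \<le> 1 / 2 * (p\<^sup>2 * k + q\<^sup>2 * k)"
      using mult_right_mono[OF sum_squares_bound[of p q] K(1)[of "fst z - snd z"], folded k_def] by (simp add: algebra_simps)
    moreover have "k \<ge> 0" using K by (simp add: k_def)
    moreover have "ennreal (1 / 2 * (p\<^sup>2 * k + q\<^sup>2 * k)) = ennreal (1/2) * (ennreal (p\<^sup>2) * ennreal k + ennreal (q\<^sup>2) * ennreal k)"
      using \<open>k \<ge> 0\<close> by (subst ennreal_mult) (simp_all add: ennreal_mult)
    ultimately have "ennreal (p * q * k) \<le> ennreal (1/2) * (ennreal (p\<^sup>2) * ennreal k + ennreal (q\<^sup>2) * ennreal k)"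
      using ennreal_leI by metis
    then show "ennreal (norm (f (fst z)) * norm (f (snd z)) * K (fst z - snd z))
      \<le> ennreal (1/2) * (?h (fst z) (snd z) + ?h (snd z) (fst z))"
      by (simp add: p_def q_def k_def Kc[of "snd z"])
  qed
  also have "\<dots> = ennreal (1/2) * (?R + ?R)"
    using 1 2 m1 m2 by (simp add: nn_integral_cmult nn_integral_add)
  also have "\<dots> = ?R"
  proof -
    have "ennreal (1/2) * (?R + ?R) = (ennreal (1/2) + ennreal (1/2)) * ?R"
      by (simp only: distrib_left distrib_right)
    also have "ennreal (1/2) + ennreal (1/2) = 1"
      by (subst ennreal_plus[symmetric]) auto
    finally show ?thesis by simp
  qed
  finally show ?thesis .
qed

text \<open>The Gaussian weight makes the triple integral absolutely convergent. Integrating over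
  the frequency first turns the weight into a convolution kernel \<open>K\<close>, and the Schur
  test bounds the result by the total mass of \<open>K\<close>, which does not depend on
  \<open>a\<close>.\<close>

lemma nn_integral_gaussian_osc_integral_sq_le:
  fixes f :: "'a::euclidean_space \<Rightarrow> complex"
  assumes f: "integrable lborel f" and s: "\<bar>s\<bar> = 1" and a: "a > 0"
  shows "(\<integral>\<^sup>+\<xi>. ennreal (exp (- a * (norm \<xi>)\<^sup>2) * (norm (osc_integral s f \<xi>))\<^sup>2) \<partial>lborel)
    \<le> ennreal ((2 * pi) ^ DIM('a)) * (\<integral>\<^sup>+x. ennreal ((norm (f x))\<^sup>2) \<partial>lborel)"
proof -
  have fm[measurable]: "f \<in> borel_measurable borel" using borel_measurable_integrable[OF f] by simp
  let ?P = "lborel \<Otimes>\<^sub>M lborel :: ('a \<times> 'a) measure"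
  define \<Phi> where "\<Phi> = (\<lambda>z::'a \<times> 'a. f (fst z) * cnj (f (snd z)))"
  have \<Phi>: "integrable lborel \<Phi>" unfolding \<Phi>_def lborel_prod[symmetric]
    by (rule integrable_lborel_tensor) (use f in auto)
  have \<Phi>m[measurable]: "\<Phi> \<in> borel_measurable borel" using borel_measurable_integrable[OF \<Phi>] by simp
  define \<eta> where "\<eta> = (\<lambda>z::'a \<times> 'a. s *\<^sub>R (fst z - snd z))"
  have \<eta>m[measurable]: "\<eta> \<in> borel_measurable borel" unfolding \<eta>_def by (intro borel_measurable_continuous_onI continuous_intros)
  define E where "E = (\<lambda>\<xi> z. exp (complex_of_real (- a * (norm \<xi>)\<^sup>2) + \<i> * complex_of_real (\<xi> \<bullet> \<eta> z)))"
  have Em: "(\<lambda>p. E (fst p) (snd p)) \<in> borel_measurable (lborel \<Otimes>\<^sub>M lborel)"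
    unfolding E_def by measurable
  \<comment> \<open>This is the integral of the weight against the phase \<open>\<eta> z\<close>;
    since \<open>\<bar>s\<bar> = 1\<close>, it depends on \<open>fst z - snd z\<close>
    alone.\<close>
  define K where "K = (\<lambda>w::'a. sqrt (pi / a) ^ DIM('a) * exp (- (norm w)\<^sup>2 / (4 * a)))"
  have Km[measurable]: "K \<in> borel_measurable borel" unfolding K_def by measurable
  have K0: "K w \<ge> 0" for w using a by (simp add: K_def)
  \<comment> \<open>The phase has modulus one, so the integrand is dominated by the tensor product
    of the Gaussian and \<open>\<Phi>\<close>.\<close>
  have int: "integrable (lborel \<Otimes>\<^sub>M lborel) (\<lambda>p. E (fst p) (snd p) * \<Phi> (snd p))"
    by (rule Bochner_Integration.integrable_bound[OF integrable_lborel_tensor[where u = "\<lambda>x. complex_of_real (exp (- a * (norm x)\<^sup>2))", OF _ \<Phi>]])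
      (use has_bochner_integral_gaussian[OF a, where 'a='a] Em in \<open>auto simp: E_def norm_mult has_bochner_integral_iff\<close>)
  have inner: "(LINT z|lborel. E \<xi> z * \<Phi> z) = complex_of_real (exp (- a * (norm \<xi>)\<^sup>2) * (norm (osc_integral s f \<xi>))\<^sup>2)" for \<xi>
  proof -
    have "(LINT z|lborel. E \<xi> z * \<Phi> z) = (LINT z|lborel. complex_of_real (exp (- a * (norm \<xi>)\<^sup>2)) * (exp (\<i> * complex_of_real (\<xi> \<bullet> \<eta> z)) * \<Phi> z))"
      by (simp add: E_def exp_add exp_of_real[symmetric] mult.assoc del: of_real_mult of_real_minus of_real_power)
    also have "\<dots> = complex_of_real (exp (- a * (norm \<xi>)\<^sup>2)) * complex_of_real ((norm (osc_integral s f \<xi>))\<^sup>2)"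
      by (subst integral_mult_right_zero) (simp only: norm_osc_integral_sq[OF f] lborel_prod \<eta>_def \<Phi>_def)
    finally show ?thesis by simp
  qed
  have outer: "(LINT \<xi>|lborel. E \<xi> z * \<Phi> z) = complex_of_real (K (fst z - snd z)) * \<Phi> z" for z
  proof -
    have "(norm (\<eta> z))\<^sup>2 = (norm (fst z - snd z))\<^sup>2" using s by (simp add: \<eta>_def)
    then show ?thesis
      using has_bochner_integral_integral_eq[OF has_bochner_integral_gaussian_fourier[OF a, of "\<eta> z"]] by (simp add: E_def K_def)
  qed
  have int': "integrable lborel (\<lambda>\<xi>. complex_of_real (exp (- a * (norm \<xi>)\<^sup>2) * (norm (osc_integral s f \<xi>))\<^sup>2))"
    using lborel_pair.integrable_fst'[OF int] by (simp only: fst_conv snd_conv inner)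
  then have intr: "integrable lborel (\<lambda>\<xi>. exp (- a * (norm \<xi>)\<^sup>2) * (norm (osc_integral s f \<xi>))\<^sup>2)"
    using integrable_Re by force
  have "(LINT \<xi>|lborel. LINT z|lborel. E \<xi> z * \<Phi> z) = (LINT z|lborel. LINT \<xi>|lborel. E \<xi> z * \<Phi> z)"
    by (rule lborel_pair.Fubini_integral[symmetric]) (use int in \<open>simp add: case_prod_beta'\<close>)
  then have eq: "complex_of_real (LINT \<xi>|lborel. exp (- a * (norm \<xi>)\<^sup>2) * (norm (osc_integral s f \<xi>))\<^sup>2)
     = (LINT z|lborel. complex_of_real (K (fst z - snd z)) * \<Phi> z)"
    unfolding inner outer by (simp only: integral_complex_of_real)
  have intz: "integrable lborel (\<lambda>z. complex_of_real (K (fst z - snd z)) * \<Phi> z)"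
    using lborel_pair.integrable_snd[of "\<lambda>\<xi> z. E \<xi> z * \<Phi> z"] int unfolding outer by (simp add: case_prod_beta')
  have "(\<integral>\<^sup>+\<xi>. ennreal (exp (- a * (norm \<xi>)\<^sup>2) * (norm (osc_integral s f \<xi>))\<^sup>2) \<partial>lborel)
     = ennreal (norm (complex_of_real (LINT \<xi>|lborel. exp (- a * (norm \<xi>)\<^sup>2) * (norm (osc_integral s f \<xi>))\<^sup>2)))"
    using intr by (subst nn_integral_eq_integral) (auto simp: abs_of_nonneg integral_nonneg_AE)
  also have "\<dots> \<le> (\<integral>\<^sup>+z. norm (complex_of_real (K (fst z - snd z)) * \<Phi> z) \<partial>lborel)"
    unfolding eq by (rule integral_norm_bound_ennreal[OF intz])
  also have "\<dots> = (\<integral>\<^sup>+z. ennreal (norm (f (fst z)) * norm (f (snd z)) * K (fst z - snd z)) \<partial>(lborel \<Otimes>\<^sub>M lborel))"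
    using K0 by (simp add: lborel_prod \<Phi>_def norm_mult mult_ac)
  also have "\<dots> \<le> (\<integral>\<^sup>+w. K w \<partial>lborel) * (\<integral>\<^sup>+x. ennreal ((norm (f x))\<^sup>2) \<partial>lborel)"
    by (rule nn_integral_convolution_form_le) (auto simp: K0, simp add: K_def)
  also have "(\<integral>\<^sup>+w. K w \<partial>lborel) = ennreal ((2 * pi) ^ DIM('a))"
  proof -
    have "has_bochner_integral lborel K (sqrt (pi / a) ^ DIM('a) * sqrt (pi / (1 / (4 * a))) ^ DIM('a))"
      using has_bochner_integral_mult_right[OF has_bochner_integral_gaussian[of "1 / (4 * a)"], of "sqrt (pi / a) ^ DIM('a)"] a
      by (simp add: K_def[abs_def])
    \<comment> \<open>The height of \<open>K\<close> and its width scale inversely in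
      \<open>a\<close>, so \<open>a\<close> cancels in each dimension and leaves a factor
      \<open>2 * pi\<close>.\<close>
    also have "sqrt (pi / a) ^ DIM('a) * sqrt (pi / (1 / (4 * a))) ^ DIM('a) = (2 * pi) ^ DIM('a)"
    proof -
      have "pi / a * (pi / (1 / (4 * a))) = (2 * pi)\<^sup>2"
        using a by (simp add: field_simps power2_eq_square)
      then have "sqrt (pi / a) * sqrt (pi / (1 / (4 * a))) = 2 * pi"
        by (simp only: real_sqrt_mult[symmetric] real_sqrt_abs) simp
      then show ?thesis by (simp only: power_mult_distrib[symmetric])
    qed
    finally show ?thesis
      using K0 by (simp add: nn_integral_eq_integral has_bochner_integral_iff)
  qed
  finally show ?thesis .
qed

text \<open>Fatou's lemma along the weights with \<open>a = 1 / (n + 1)\<close>, whose integrals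
  have a bound uniform in \<open>n\<close>.\<close>

lemma nn_integral_osc_integral_sq_le:
  fixes f :: "'a::euclidean_space \<Rightarrow> complex"
  assumes f: "integrable lborel f" and s: "\<bar>s\<bar> = 1"
  shows "(\<integral>\<^sup>+\<xi>. ennreal ((norm (osc_integral s f \<xi>))\<^sup>2) \<partial>lborel)
    \<le> ennreal ((2 * pi) ^ DIM('a)) * (\<integral>\<^sup>+x. ennreal ((norm (f x))\<^sup>2) \<partial>lborel)"
proof -
  have [measurable]: "osc_integral s f \<in> borel_measurable borel"
    using borel_measurable_osc_integral borel_measurable_integrable[OF f] by simp
  let ?g = "\<lambda>n \<xi>. ennreal (exp (- inverse (real (Suc n)) * (norm \<xi>)\<^sup>2) * (norm (osc_integral s f \<xi>))\<^sup>2)"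
  have lim: "(\<lambda>n. ?g n \<xi>) \<longlonglongrightarrow> ennreal ((norm (osc_integral s f \<xi>))\<^sup>2)" for \<xi>
  proof -
    have "(\<lambda>n. exp (- inverse (real (Suc n)) * (norm \<xi>)\<^sup>2) * (norm (osc_integral s f \<xi>))\<^sup>2) \<longlonglongrightarrow> exp (- 0 * (norm \<xi>)\<^sup>2) * (norm (osc_integral s f \<xi>))\<^sup>2"
      by (intro tendsto_intros LIMSEQ_inverse_real_of_nat)
    then show ?thesis by (intro tendsto_ennrealI) simp
  qed
  have "(\<integral>\<^sup>+\<xi>. ennreal ((norm (osc_integral s f \<xi>))\<^sup>2) \<partial>lborel) = (\<integral>\<^sup>+\<xi>. liminf (\<lambda>n. ?g n \<xi>) \<partial>lborel)"
    by (intro nn_integral_cong) (simp only: lim_imp_Liminf[OF sequentially_bot lim])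
  also have "\<dots> \<le> liminf (\<lambda>n. \<integral>\<^sup>+\<xi>. ?g n \<xi> \<partial>lborel)"
    by (intro nn_integral_liminf) measurable
  also have "\<dots> \<le> liminf (\<lambda>n::nat. ennreal ((2 * pi) ^ DIM('a)) * (\<integral>\<^sup>+x. ennreal ((norm (f x))\<^sup>2) \<partial>lborel))"
    by (intro Liminf_mono always_eventually allI nn_integral_gaussian_osc_integral_sq_le f s) simp
  finally show ?thesis by (simp add: Liminf_const)
qed

section \<open>The transforms of Schwartz functions\<close>

lemma schwartz_continuous: "f \<in> schwartz \<Longrightarrow> continuous_on UNIV f"
  unfolding schwartz_def
  by (auto simp: continuous_on_eq_continuous_at intro!: differentiable_imp_continuous_within dest!: spec[of _ "[]"])

lemma schwartz_bounded:
  assumes "f \<in> schwartz"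
  obtains C where "\<And>x. norm x ^ N * norm (f x) \<le> C"
  using assms unfolding schwartz_def by (force dest!: spec[of _ "[]"])

text \<open>A majorant of product form reduces integrability on the whole space to the
  one-dimensional arctangent integral. It is complex-valued to fit the product lemma.\<close>

lemma integrable_prod_inverse_1_plus_square:
  "integrable lborel (\<lambda>x::'a::euclidean_space. \<Prod>b\<in>Basis. complex_of_real (inverse (1 + (x \<bullet> b)\<^sup>2)))"
proof -
  have "integrable lborel (\<lambda>x::real. inverse (1 + x\<^sup>2))"
    using integrable_inverse_1_plus_square by (simp add: set_integrable_def)
  then have "has_bochner_integral lborel (\<lambda>x::real. complex_of_real (inverse (1 + x\<^sup>2)))
    (LINT x|lborel. complex_of_real (inverse (1 + x\<^sup>2)))"
    by (intro has_bochner_integral_integrable) (simp only: complex_of_real_integrable_eq)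
  then show ?thesis
    using has_bochner_integral_lborel_prod[where 'a='a and f = "\<lambda>_ y. complex_of_real (inverse (1 + y\<^sup>2))"]
    by (auto simp: has_bochner_integral_iff)
qed

text \<open>In dimension two the product of the \<open>1 + (x \<bullet> b)\<^sup>2\<close> is at
  most \<open>(1 + (norm x)\<^sup>2)\<^sup>2\<close>. Expanding this square shows that the decay
  bounds with exponents 0, 2 and 4 suffice.\<close>

lemma schwartz_integrable:
  assumes f: "f \<in> schwartz"
  shows "integrable lborel f"
proof -
  obtain A where A: "\<And>x. norm x ^ 0 * norm (f x) \<le> A" using schwartz_bounded[OF f] by metis
  obtain B where B: "\<And>x. norm x ^ 2 * norm (f x) \<le> B" using schwartz_bounded[OF f] by metis
  obtain C where C: "\<And>x. norm x ^ 4 * norm (f x) \<le> C" using schwartz_bounded[OF f] by metis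
  let ?P = "\<lambda>x::real^2. \<Prod>b\<in>Basis. (1 + (x \<bullet> b)\<^sup>2)"
  have bound: "norm (f x) \<le> (A + 2 * B + C) * inverse (?P x)" for x
  proof -
    have pos: "?P x > 0" by (intro prod_pos) (auto intro: add_pos_nonneg)
    have "?P x \<le> (\<Prod>b\<in>(Basis :: (real^2) set). (1 + (norm x)\<^sup>2))"
      by (intro prod_mono) (auto intro!: abs_le_square_iff[THEN iffD1] simp: Basis_le_norm)
    also have "\<dots> = (1 + (norm x)\<^sup>2)\<^sup>2" by simp
    finally have "norm (f x) * ?P x \<le> norm (f x) * (1 + (norm x)\<^sup>2)\<^sup>2"
      by (rule mult_left_mono) simp
    also have "(1 + (norm x)\<^sup>2)\<^sup>2 = norm x ^ 0 + 2 * norm x ^ 2 + norm x ^ 4"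
      by (simp add: power2_sum)
    also have "norm (f x) * \<dots> \<le> A + 2 * B + C"
      using A[of x] B[of x] C[of x] by (simp add: algebra_simps)
    finally show ?thesis using pos by (simp add: field_simps)
  qed
  show ?thesis
  proof (rule Bochner_Integration.integrable_bound)
    show "integrable lborel (\<lambda>x::real^2. complex_of_real (A + 2 * B + C) * (\<Prod>b\<in>Basis. complex_of_real (inverse (1 + (x \<bullet> b)\<^sup>2))))"
      by (intro integrable_mult_right integrable_prod_inverse_1_plus_square)
    show "f \<in> borel_measurable lborel"
      using borel_measurable_continuous_onI[OF schwartz_continuous[OF f]] by simp
    have "(\<Prod>b\<in>Basis. complex_of_real (inverse (1 + (x \<bullet> b)\<^sup>2))) = complex_of_real (inverse (?P x))" for x :: "real^2"
      by (simp only: of_real_prod[symmetric] prod_inversef[symmetric] o_def)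
    then have "norm (complex_of_real (A + 2 * B + C) * (\<Prod>b\<in>Basis. complex_of_real (inverse (1 + (x \<bullet> b)\<^sup>2)))) = \<bar>(A + 2 * B + C) * inverse (?P x)\<bar>" for x :: "real^2"
      by (simp only: of_real_mult[symmetric] norm_of_real)
    then show "AE x in lborel. norm (f x) \<le> norm (complex_of_real (A + 2 * B + C) * (\<Prod>b\<in>Basis. complex_of_real (inverse (1 + (x \<bullet> b)\<^sup>2))))"
      using bound by (simp only: AE_I2 order_trans[OF _ abs_ge_self])
  qed
qed

lemma schwartz_L2:
  assumes f: "f \<in> schwartz"
  shows "f \<in> L2"
proof -
  obtain A where A: "\<And>x. norm x ^ 0 * norm (f x) \<le> A" using schwartz_bounded[OF f] by metis
  have m: "f \<in> borel_measurable lborel"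
    using borel_measurable_integrable[OF schwartz_integrable[OF f]] .
  have "integrable lborel (\<lambda>x. (norm (f x))\<^sup>2)"
  proof (rule Bochner_Integration.integrable_bound)
    show "integrable lborel (\<lambda>x. complex_of_real A * f x)"
      by (intro integrable_mult_right schwartz_integrable f)
    show "(\<lambda>x. (norm (f x))\<^sup>2) \<in> borel_measurable lborel" using m by measurable
    show "AE x in lborel. norm ((norm (f x))\<^sup>2) \<le> norm (complex_of_real A * f x)"
      using A by (auto simp: norm_mult power2_eq_square intro!: AE_I2 mult_right_mono order_trans[OF _ abs_ge_self])
  qed
  with m show ?thesis by (simp add: L2_def)
qed

text \<open>The sign \<open>s\<close> is \<open>-1\<close> for the Fourier transform and \<open>1\<close> for its inverse.\<close>

definition ft :: "real \<Rightarrow> (real ^ 2 \<Rightarrow> complex) \<Rightarrow> real ^ 2 \<Rightarrow> complex" where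
  "ft s f \<xi> = complex_of_real (1 / (2 * pi)) * osc_integral s f \<xi>"

lemma fourier_integral_eq_ft: "fourier_integral = ft (- 1)"
  by (intro ext) (simp add: fourier_integral_def ft_def osc_integral_def)

lemma inv_fourier_integral_eq_ft: "inv_fourier_integral = ft 1"
  by (intro ext) (simp add: inv_fourier_integral_def ft_def osc_integral_def inner_commute)

lemma ft_measurable:
  assumes "integrable lborel f"
  shows "ft s f \<in> borel_measurable lborel"
  using borel_measurable_osc_integral[of f s] borel_measurable_integrable[OF assms]
  unfolding ft_def[abs_def] by (intro borel_measurable_times) auto

text \<open>In dimension two the squared normalization \<open>(1 / (2 * pi))\<^sup>2\<close> cancels
  the Plancherel constant exactly. Stated for differences, the bound compares the transforms along
  two approximations directly.\<close>

lemma ft_contraction: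
  assumes u: "integrable lborel u" and v: "integrable lborel v" and s: "\<bar>s\<bar> = 1"
  shows "(\<integral>\<^sup>+x. ennreal ((norm (ft s u x - ft s v x))\<^sup>2) \<partial>lborel)
    \<le> (\<integral>\<^sup>+x. ennreal ((norm (u x - v x))\<^sup>2) \<partial>lborel)"
proof -
  have uv: "integrable lborel (\<lambda>x. u x - v x)" using u v by simp
  let ?o = "osc_integral s (\<lambda>x. u x - v x)"
  have [measurable]: "?o \<in> borel_measurable borel"
    using borel_measurable_osc_integral borel_measurable_integrable[OF uv] by simp
  have "osc_integral s u x - osc_integral s v x = ?o x" for x
    unfolding osc_integral_def right_diff_distrib
    by (rule Bochner_Integration.integral_diff[symmetric]) (intro integrable_osc u v)+
  then have "ft s u x - ft s v x = complex_of_real (1 / (2 * pi)) * ?o x" for x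
    by (simp only: ft_def right_diff_distrib[symmetric])
  then have "(\<integral>\<^sup>+x. ennreal ((norm (ft s u x - ft s v x))\<^sup>2) \<partial>lborel)
    = (\<integral>\<^sup>+x. ennreal ((1 / (2 * pi))\<^sup>2) * ennreal ((norm (?o x))\<^sup>2) \<partial>lborel)"
    by (simp only: norm_mult power_mult_distrib norm_of_real power2_abs ennreal_mult' zero_le_power2)
  also have "\<dots> = ennreal ((1 / (2 * pi))\<^sup>2) * (\<integral>\<^sup>+x. ennreal ((norm (?o x))\<^sup>2) \<partial>lborel)"
    by (rule nn_integral_cmult) measurable
  also have "\<dots> \<le> ennreal ((1 / (2 * pi))\<^sup>2) * (ennreal ((2 * pi) ^ DIM(real^2)) * (\<integral>\<^sup>+x. ennreal ((norm (u x - v x))\<^sup>2) \<partial>lborel))"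
    by (intro mult_left_mono nn_integral_osc_integral_sq_le uv s) simp
  also have "\<dots> = (\<integral>\<^sup>+x. ennreal ((norm (u x - v x))\<^sup>2) \<partial>lborel)"
  proof -
    have "(1 / (2 * pi))\<^sup>2 * (2 * pi) ^ DIM(real^2) = 1"
      by (simp add: power_mult_distrib power_divide)
    then have "ennreal ((1 / (2 * pi))\<^sup>2) * ennreal ((2 * pi) ^ DIM(real^2)) = 1"
      by (subst ennreal_mult[symmetric]) simp_all
    then show ?thesis by (simp only: mult.assoc[symmetric] mult_1_left)
  qed
  finally show ?thesis .
qed

lemma ft_schwartz_L2:
  assumes f: "f \<in> schwartz" and s: "\<bar>s\<bar> = 1"
  shows "ft s f \<in> L2"
proof -
  have i: "integrable lborel f" using f by (rule schwartz_integrable)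
  have [measurable]: "ft s f \<in> borel_measurable lborel" using i by (rule ft_measurable)
  have "(\<integral>\<^sup>+x. ennreal ((norm (ft s f x))\<^sup>2) \<partial>lborel) \<le> (\<integral>\<^sup>+x. ennreal ((norm (f x))\<^sup>2) \<partial>lborel)"
    using ft_contraction[OF i _ s, of "\<lambda>_. 0"] by (simp add: ft_def osc_integral_def)
  also have "\<dots> < \<infinity>"
    using schwartz_L2[OF f] by (simp add: L2_def integrable_iff_bounded)
  finally have "integrable lborel (\<lambda>x. (norm (ft s f x))\<^sup>2)"
    by (intro integrableI_bounded) auto
  then show ?thesis by (simp add: L2_def)
qed

section \<open>Identification of the extended transforms on Schwartz functions\<close>

lemma norm_diff_sq_le: "(norm (a - b :: complex))\<^sup>2 \<le> 2 * (norm (c - a))\<^sup>2 + 2 * (norm (c - b))\<^sup>2"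
proof -
  have "norm (a - b) \<le> norm (c - a) + norm (c - b)"
    using norm_triangle_ineq4[of "c - b" "c - a"] by (simp add: algebra_simps)
  then have "(norm (a - b))\<^sup>2 \<le> (norm (c - a) + norm (c - b))\<^sup>2" by (intro power_mono) auto
  also have "\<dots> \<le> 2 * (norm (c - a))\<^sup>2 + 2 * (norm (c - b))\<^sup>2"
    using zero_le_power2[of "norm (c - a) - norm (c - b)"] unfolding power2_sum power2_diff by simp
  finally show ?thesis .
qed

text \<open>The contraction forces every admissible limit to agree almost everywhere with the
  integral transform, so the choice in \<open>L2_extension\<close> is harmless. The hypothesis on
  \<open>f\<close> is an almost-everywhere equality because the heat multiplier is applied to
  \<open>fourier f\<close>, which is itself known only up to null sets.\<close>

lemma L2_extension_ft:
  assumes f0: "f0 \<in> schwartz" and f: "AE x in lborel. f x = f0 x" and s: "\<bar>s\<bar> = 1"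
  shows "L2_extension (ft s) f \<in> L2" "AE x in lborel. L2_extension (ft s) f x = ft s f0 x"
proof -
  let ?Q = "\<lambda>g. g \<in> L2 \<and> (\<exists>\<phi>. (\<forall>n. \<phi> n \<in> schwartz) \<and> L2_tendsto \<phi> f \<and> L2_tendsto (\<lambda>n. ft s (\<phi> n)) g)"
  have "(\<integral>\<^sup>+ x. ennreal ((norm (f0 x - f x))\<^sup>2) \<partial>lborel) = (\<integral>\<^sup>+ x. 0 \<partial>(lborel :: (real^2) measure))"
    by (rule nn_integral_cong_AE) (use f in eventually_elim, simp)
  \<comment> \<open>The constant sequence \<open>f0\<close> is admissible, so the choice operator
    has a witness.\<close>
  then have "?Q (ft s f0)"
    using ft_schwartz_L2[OF f0 s] f0 by (intro conjI exI[of _ "\<lambda>_. f0"]) (auto simp: L2_tendsto_def)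
  then have "?Q (L2_extension (ft s) f)" unfolding L2_extension_def by (rule someI[where P = ?Q])
  moreover define g where "g = L2_extension (ft s) f"
  ultimately obtain \<phi> where g: "g \<in> L2" and \<phi>: "\<And>n. \<phi> n \<in> schwartz" "L2_tendsto \<phi> f"
    "L2_tendsto (\<lambda>n. ft s (\<phi> n)) g" by blast
  show "L2_extension (ft s) f \<in> L2" using g by (simp add: g_def)
  have i0: "integrable lborel f0" and i\<phi>: "integrable lborel (\<phi> n)" for n
    using schwartz_integrable f0 \<phi> by auto
  have m[measurable]: "g \<in> borel_measurable lborel" "ft s f0 \<in> borel_measurable lborel"
    "ft s (\<phi> n) \<in> borel_measurable lborel" for n
    using g ft_measurable i0 i\<phi> by (auto simp: L2_def)
  let ?a = "\<lambda>n. \<integral>\<^sup>+ x. ennreal ((norm (\<phi> n x - f x))\<^sup>2) \<partial>lborel"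
  let ?b = "\<lambda>n. \<integral>\<^sup>+ x. ennreal ((norm (ft s (\<phi> n) x - g x))\<^sup>2) \<partial>lborel"
  let ?d = "\<integral>\<^sup>+ x. ennreal ((norm (ft s f0 x - g x))\<^sup>2) \<partial>lborel"
  \<comment> \<open>The approximant \<open>ft s (\<phi> n)\<close> is inserted between the two
    functions; the contraction moves the first distance back to \<open>\<phi> n\<close> and
    \<open>f0\<close>, and \<open>f0\<close> may be replaced by \<open>f\<close> under the integral.
    Both terms vanish in the limit.\<close>
  have le: "?d \<le> 2 * ?a n + 2 * ?b n" for n
  proof -
    have "?d \<le> (\<integral>\<^sup>+ x. 2 * ennreal ((norm (ft s (\<phi> n) x - ft s f0 x))\<^sup>2) + 2 * ennreal ((norm (ft s (\<phi> n) x - g x))\<^sup>2) \<partial>lborel)"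
    proof (intro nn_integral_mono)
      fix x
      have "ennreal ((norm (ft s f0 x - g x))\<^sup>2) \<le> ennreal (2 * (norm (ft s (\<phi> n) x - ft s f0 x))\<^sup>2 + 2 * (norm (ft s (\<phi> n) x - g x))\<^sup>2)"
        by (intro ennreal_leI norm_diff_sq_le)
      then show "ennreal ((norm (ft s f0 x - g x))\<^sup>2) \<le> 2 * ennreal ((norm (ft s (\<phi> n) x - ft s f0 x))\<^sup>2) + 2 * ennreal ((norm (ft s (\<phi> n) x - g x))\<^sup>2)"
        by (simp add: ennreal_mult)
    qed
    also have "\<dots> = 2 * (\<integral>\<^sup>+ x. ennreal ((norm (ft s (\<phi> n) x - ft s f0 x))\<^sup>2) \<partial>lborel) + 2 * ?b n"
      by (subst nn_integral_add) (auto simp: nn_integral_cmult)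
    also have "(\<integral>\<^sup>+ x. ennreal ((norm (ft s (\<phi> n) x - ft s f0 x))\<^sup>2) \<partial>lborel) \<le> (\<integral>\<^sup>+ x. ennreal ((norm (\<phi> n x - f0 x))\<^sup>2) \<partial>lborel)"
      by (rule ft_contraction[OF i\<phi> i0 s])
    also have "(\<integral>\<^sup>+ x. ennreal ((norm (\<phi> n x - f0 x))\<^sup>2) \<partial>lborel) = ?a n"
      by (rule nn_integral_cong_AE) (use f in eventually_elim, simp)
    finally show ?thesis by (simp add: add_mono mult_left_mono)
  qed
  have "(\<lambda>n. 2 * ?a n + 2 * ?b n) \<longlonglongrightarrow> 2 * 0 + 2 * 0"
    using \<phi>(2,3) unfolding L2_tendsto_def by (intro tendsto_add ennreal_tendsto_cmult) auto
  then have "?d \<le> 2 * 0 + 2 * 0"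
    by (rule LIMSEQ_le_const) (use le in blast)
  then have "AE x in lborel. ennreal ((norm (ft s f0 x - g x))\<^sup>2) = 0"
    by (subst nn_integral_0_iff_AE[symmetric]) auto
  then show "AE x in lborel. L2_extension (ft s) f x = ft s f0 x"
    unfolding g_def[symmetric] by eventually_elim simp
qed

section \<open>Transforms of sums of Gaussians\<close>

lemma integrable_gauss: "a > 0 \<Longrightarrow> integrable lborel (gauss a)"
  using has_bochner_integral_gaussian[of a, where 'a="real^2"]
  by (simp only: gauss_def[abs_def] complex_of_real_integrable_eq has_bochner_integral_iff)

lemma ft_gauss:
  assumes "a > 0" "\<bar>s\<bar> = 1"
  shows "ft s (gauss a) \<xi> = complex_of_real (1 / (2 * a)) * gauss (1 / (4 * a)) \<xi>"
proof -
  have "osc_integral s (gauss a) \<xi> = (LINT x|lborel. exp (complex_of_real (- a * (norm x)\<^sup>2) + \<i> * complex_of_real (x \<bullet> (s *\<^sub>R \<xi>))))"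
    unfolding osc_integral_def gauss_def exp_add
    by (simp only: exp_of_real inner_scaleR_right mult.commute)
  also have "\<dots> = complex_of_real (sqrt (pi / a) ^ DIM(real^2) * exp (- (norm (s *\<^sub>R \<xi>))\<^sup>2 / (4 * a)))"
    by (rule has_bochner_integral_integral_eq has_bochner_integral_gaussian_fourier assms)+
  also have "sqrt (pi / a) ^ DIM(real^2) = pi / a" using assms by simp
  also have "- (norm (s *\<^sub>R \<xi>))\<^sup>2 / (4 * a) = - (1 / (4 * a)) * (norm \<xi>)\<^sup>2" using assms by simp
  finally show ?thesis
    unfolding ft_def gauss_def of_real_mult[symmetric] by (simp add: mult.assoc[symmetric] del: mult_minus_left)
qed

lemma ft_gauss_sum:
  assumes a: "\<And>k. k \<in> A \<Longrightarrow> a k > 0" and s: "\<bar>s\<bar> = 1"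
  shows "ft s (\<lambda>x. \<Sum>k\<in>A. c k * gauss (a k) x)
    = (\<lambda>\<xi>. \<Sum>k\<in>A. c k * (complex_of_real (1 / (2 * a k)) * gauss (1 / (4 * a k)) \<xi>))"
proof
  fix \<xi> :: "real ^ 2"
  let ?e = "\<lambda>x. exp (\<i> * complex_of_real (s * (x \<bullet> \<xi>)))"
  have "osc_integral s (\<lambda>x. \<Sum>k\<in>A. c k * gauss (a k) x) \<xi> = (LINT x|lborel. (\<Sum>k\<in>A. c k * (?e x * gauss (a k) x)))"
    unfolding osc_integral_def sum_distrib_left by (simp only: mult.left_commute)
  also have "\<dots> = (\<Sum>k\<in>A. LINT x|lborel. c k * (?e x * gauss (a k) x))"
    by (intro Bochner_Integration.integral_sum integrable_mult_right integrable_osc integrable_gauss a)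
  also have "\<dots> = (\<Sum>k\<in>A. c k * osc_integral s (gauss (a k)) \<xi>)"
    unfolding osc_integral_def by (simp only: integral_mult_right_zero)
  finally show "ft s (\<lambda>x. \<Sum>k\<in>A. c k * gauss (a k) x) \<xi>
    = (\<Sum>k\<in>A. c k * (complex_of_real (1 / (2 * a k)) * gauss (1 / (4 * a k)) \<xi>))"
    using ft_gauss[OF a s, of _ \<xi>, unfolded ft_def]
    unfolding ft_def by (simp add: sum_distrib_left mult.left_commute)
qed

section \<open>The lower bound\<close>

text \<open>The set where the property fails is open, and a nonempty open set is not Lebesgue null.
  This turns almost-everywhere statements on continuous representatives into statements at a single
  point.\<close>

lemma AE_lborel_continuous_closed:
  fixes u :: "'a::euclidean_space \<Rightarrow> 'b::topological_space"
  assumes ae: "AE x in lborel. u x \<in> C" and u: "continuous_on UNIV u" and C: "closed C"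
  shows "u x \<in> C"
proof (rule ccontr)
  assume "u x \<notin> C"
  then have "u -` (- C) \<noteq> {}" by auto
  moreover have o: "open (u -` (- C))"
    using u C by (auto intro: open_vimage)
  ultimately have "\<not> negligible (u -` (- C))" using open_not_negligible by blast
  moreover have "u -` (- C) \<in> null_sets lborel"
    using ae o by (subst AE_iff_null_sets) auto
  ultimately show False
    by (simp add: negligible_iff_null_sets null_sets_completionI)
qed

text \<open>The values bounded in norm by the essential supremum form a closed set, so the bound
  holds at every point of the continuous representative.\<close>

lemma Linf_norm_ge:
  assumes ae: "AE x in lborel. g x = u x" and u: "continuous_on UNIV u"
  shows "ennreal (norm (u x)) \<le> Linf_norm g"
proof -
  have "AE x in lborel. ennreal (norm (g x)) \<le> Linf_norm g"
    unfolding Linf_norm_def by (rule esssup_AE)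
  with ae have "AE x in lborel. u x \<in> {z. ennreal (norm z) \<le> Linf_norm g}"
    by eventually_elim simp
  moreover have "closed {z::complex. ennreal (norm z) \<le> Linf_norm g}"
    by (intro closed_Collect_le continuous_intros continuous_on_ennreal)
  ultimately have "u x \<in> {z. ennreal (norm z) \<le> Linf_norm g}"
    using u by (intro AE_lborel_continuous_closed)
  then show ?thesis by simp
qed

text \<open>The interaction is independent of \<open>t\<close> and at most
  \<open>2 ^ k / 2 ^ n\<close> between scales \<open>k\<close> and \<open>n\<close>. Adding scale
  \<open>n\<close> therefore adds two equal geometric sums, each at most 1, and a diagonal term at
  most 1, which gives the constant 3.\<close>

lemma sum_dyadic_interaction:
  fixes t :: real
  assumes t: "t > 0"
  shows "(\<Sum>j<n. \<Sum>k<n. (t * 2 ^ j) * (t * 2 ^ k) / (t * 2 ^ j + t * 2 ^ k)\<^sup>2) \<le> 3 * real n"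
proof (induction n)
  case 0
  then show ?case by simp
next
  case (Suc n)
  let ?w = "\<lambda>j k. (t * 2 ^ j) * (t * 2 ^ k) / (t * 2 ^ j + t * 2 ^ k)\<^sup>2"
  have sym: "?w j k = ?w k j" for j k by (simp only: mult.commute add.commute)
  have w: "?w n k \<le> 2 ^ k / 2 ^ n" for k
  proof -
    have "(t * 2 ^ n)\<^sup>2 \<le> (t * 2 ^ n + t * 2 ^ k)\<^sup>2" using t by (intro power_mono) auto
    then have "?w n k \<le> (t * 2 ^ n) * (t * 2 ^ k) / (t * 2 ^ n)\<^sup>2"
      using t by (intro divide_left_mono mult_pos_pos zero_less_power add_pos_pos mult_nonneg_nonneg) auto
    also have "\<dots> = 2 ^ k / 2 ^ n" using t by (simp add: power2_eq_square)
    finally show ?thesis .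
  qed
  have g: "(\<Sum>k<m. 2 ^ k) \<le> (2 ^ m :: real)" for m by (induction m) auto
  have "(\<Sum>k<n. ?w n k) \<le> (\<Sum>k<n. 2 ^ k / 2 ^ n)" by (intro sum_mono w)
  also have "\<dots> \<le> 1" using g[of n] by (simp add: sum_divide_distrib[symmetric])
  finally have 1: "(\<Sum>k<n. ?w n k) \<le> 1" .
  have "(\<Sum>j<Suc n. \<Sum>k<Suc n. ?w j k) = (\<Sum>j<n. \<Sum>k<n. ?w j k) + (\<Sum>j<n. ?w j n) + ((\<Sum>k<n. ?w n k) + ?w n n)"
    by (simp only: sum.lessThan_Suc sum.distrib)
  also have "(\<Sum>j<n. ?w j n) = (\<Sum>k<n. ?w n k)" by (intro sum.cong refl sym)
  finally show ?case using Suc 1 w[of n] by simp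
qed

text \<open>Only an upper bound on the denominator has to be known; it may even vanish.\<close>

lemma ennreal_divide_ge:
  assumes "ennreal v \<le> L" "0 < v" "0 \<le> h" "h \<le> h'" "0 < h'"
  shows "ennreal (v / h') \<le> L / ennreal h"
proof (cases "h = 0")
  \<comment> \<open>Since \<open>L\<close> is positive, its quotient by zero in
    \<open>ennreal\<close> is infinite.\<close>
  case True
  then show ?thesis using assms by auto
next
  case False
  then have "ennreal (v / h') \<le> ennreal (v / h)" using assms by (intro ennreal_leI divide_left_mono) auto
  also have "\<dots> = ennreal v / ennreal h" using False assms by (simp add: divide_ennreal)
  also have "\<dots> \<le> L / ennreal h" using assms by (intro divide_right_mono_ennreal)
  finally show ?thesis .
qed

text \<open>The square is expanded into pairs of Gaussians with exponent
  \<open>a = \<sigma> j + \<sigma> k\<close>. Half of that exponent absorbs the weight at the price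
  of a factor \<open>2 / a\<close>; the remaining Gaussian integrates to \<open>2 * pi / a\<close>,
  so each pair contributes \<open>4 * pi / a\<^sup>2\<close> times its coefficients.\<close>

lemma gauss_sum_weighted_L2:
  fixes \<sigma> :: "nat \<Rightarrow> real"
  assumes \<sigma>: "\<And>k. k < n \<Longrightarrow> 0 < \<sigma> k" "\<And>k. k < n \<Longrightarrow> \<sigma> k \<le> 1"
  defines "g \<equiv> \<lambda>\<xi>. \<Sum>k<n. complex_of_real (\<sigma> k) * gauss (\<sigma> k) \<xi>"
  shows "integrable lborel (\<lambda>\<xi>. (1 + (norm \<xi>)\<^sup>2) * (norm (g \<xi>))\<^sup>2)"
    and "(LINT \<xi>|lborel. (1 + (norm \<xi>)\<^sup>2) * (norm (g \<xi>))\<^sup>2)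
      \<le> 4 * pi * (\<Sum>j<n. \<Sum>k<n. \<sigma> j * \<sigma> k / (\<sigma> j + \<sigma> k)\<^sup>2)"
proof -
  let ?B = "\<lambda>\<xi>::real^2. \<Sum>j<n. \<Sum>k<n. \<sigma> j * \<sigma> k * (2 / (\<sigma> j + \<sigma> k)) * exp (- ((\<sigma> j + \<sigma> k) / 2) * (norm \<xi>)\<^sup>2)"
  let ?I = "\<Sum>j<n. \<Sum>k<n. \<sigma> j * \<sigma> k * (2 / (\<sigma> j + \<sigma> k)) * (sqrt (pi / ((\<sigma> j + \<sigma> k) / 2)) ^ DIM(real^2))"
  have B: "has_bochner_integral lborel ?B ?I"
    by (intro has_bochner_integral_sum has_bochner_integral_mult_right has_bochner_integral_gaussian)
      (use \<sigma> in \<open>auto intro: add_pos_pos\<close>)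
  have gr: "g \<xi> = complex_of_real (\<Sum>k<n. \<sigma> k * exp (- \<sigma> k * (norm \<xi>)\<^sup>2))" for \<xi>
    by (simp only: g_def gauss_def of_real_sum of_real_mult)
  have le: "(1 + (norm \<xi>)\<^sup>2) * (norm (g \<xi>))\<^sup>2 \<le> ?B \<xi>" for \<xi>
  proof -
    have "(norm (g \<xi>))\<^sup>2 = (\<Sum>j<n. \<sigma> j * exp (- \<sigma> j * (norm \<xi>)\<^sup>2)) * (\<Sum>k<n. \<sigma> k * exp (- \<sigma> k * (norm \<xi>)\<^sup>2))"
      unfolding gr norm_of_real power2_abs by (rule power2_eq_square)
    then have "(1 + (norm \<xi>)\<^sup>2) * (norm (g \<xi>))\<^sup>2 =
      (\<Sum>j<n. \<Sum>k<n. (1 + (norm \<xi>)\<^sup>2) * ((\<sigma> j * exp (- \<sigma> j * (norm \<xi>)\<^sup>2)) * (\<sigma> k * exp (- \<sigma> k * (norm \<xi>)\<^sup>2))))"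
      by (simp only: sum_product) (simp only: sum_distrib_left)
    also have "\<dots> \<le> ?B \<xi>"
    proof (intro sum_mono)
      fix j k assume jk: "j \<in> {..<n}" "k \<in> {..<n}"
      define a r where "a = \<sigma> j + \<sigma> k" and "r = (norm \<xi>)\<^sup>2"
      have a: "0 < a" "a \<le> 2" and r: "r \<ge> 0" and p: "0 < \<sigma> j" "0 < \<sigma> k"
        using \<sigma>[of j] \<sigma>[of k] jk by (auto simp: a_def r_def)
      \<comment> \<open>Here \<open>a \<le> 2\<close> enters, which is where the scales have to be
        at most 1.\<close>
      have "1 + r \<le> 2 / a * (1 + a * r / 2)" using a r by (simp add: field_simps)
      also have "\<dots> \<le> 2 / a * exp (a * r / 2)"
        using a exp_ge_add_one_self[of "a * r / 2"] by (intro mult_left_mono) auto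
      finally have "(1 + r) * exp (- a * r) \<le> 2 / a * exp (a * r / 2) * exp (- a * r)"
        by (rule mult_right_mono) simp
      also have "\<dots> = 2 / a * exp (- (a / 2) * r)"
        by (simp add: mult.assoc exp_add[symmetric])
      finally have "(\<sigma> j * \<sigma> k) * ((1 + r) * exp (- a * r)) \<le> (\<sigma> j * \<sigma> k) * (2 / a * exp (- (a / 2) * r))"
        by (rule mult_left_mono) (use p in simp)
      moreover have "exp (- \<sigma> j * r) * exp (- \<sigma> k * r) = exp (- a * r)"
        by (simp add: a_def exp_add[symmetric] algebra_simps)
      then have "(1 + r) * ((\<sigma> j * exp (- \<sigma> j * r)) * (\<sigma> k * exp (- \<sigma> k * r))) = (\<sigma> j * \<sigma> k) * ((1 + r) * exp (- a * r))"
        by (metis (no_types, opaque_lifting) mult.assoc mult.commute)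
      ultimately show "(1 + (norm \<xi>)\<^sup>2) * ((\<sigma> j * exp (- \<sigma> j * (norm \<xi>)\<^sup>2)) * (\<sigma> k * exp (- \<sigma> k * (norm \<xi>)\<^sup>2)))
        \<le> \<sigma> j * \<sigma> k * (2 / (\<sigma> j + \<sigma> k)) * exp (- ((\<sigma> j + \<sigma> k) / 2) * (norm \<xi>)\<^sup>2)"
        unfolding a_def r_def by (simp only: mult.assoc)
    qed
    finally show ?thesis .
  qed
  have [measurable]: "g \<in> borel_measurable lborel"
    unfolding g_def gauss_def by measurable
  show int: "integrable lborel (\<lambda>\<xi>. (1 + (norm \<xi>)\<^sup>2) * (norm (g \<xi>))\<^sup>2)"
  proof (rule Bochner_Integration.integrable_bound)
    show "integrable lborel ?B" using B by (simp add: has_bochner_integral_iff)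
    have "norm ((1 + (norm \<xi>)\<^sup>2) * (norm (g \<xi>))\<^sup>2) \<le> norm (?B \<xi>)" for \<xi>
      using le[of \<xi>] by (simp only: real_norm_def abs_mult abs_power2 abs_norm_cancel abs_of_nonneg add_nonneg_nonneg zero_le_one zero_le_power2)
    then show "AE \<xi> in lborel. norm ((1 + (norm \<xi>)\<^sup>2) * (norm (g \<xi>))\<^sup>2) \<le> norm (?B \<xi>)" by (rule AE_I2)
  qed measurable
  have "(LINT \<xi>|lborel. (1 + (norm \<xi>)\<^sup>2) * (norm (g \<xi>))\<^sup>2) \<le> (LINT \<xi>|lborel. ?B \<xi>)"
    using B by (intro integral_mono int le) (simp add: has_bochner_integral_iff)
  also have "\<dots> = ?I" using B by (rule has_bochner_integral_integral_eq)
  also have "\<dots> = 4 * pi * (\<Sum>j<n. \<Sum>k<n. \<sigma> j * \<sigma> k / (\<sigma> j + \<sigma> k)\<^sup>2)"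
    unfolding sum_distrib_left
  proof (intro sum.cong refl)
    fix j k assume jk: "j \<in> {..<n}" "k \<in> {..<n}"
    then have p: "\<sigma> j + \<sigma> k > 0" using \<sigma>[of j] \<sigma>[of k] by (auto intro: add_pos_pos)
    then have "sqrt (pi / ((\<sigma> j + \<sigma> k) / 2)) ^ DIM(real^2) = 2 * pi / (\<sigma> j + \<sigma> k)" by simp
    then show "\<sigma> j * \<sigma> k * (2 / (\<sigma> j + \<sigma> k)) * (sqrt (pi / ((\<sigma> j + \<sigma> k) / 2)) ^ DIM(real^2)) = 4 * pi * (\<sigma> j * \<sigma> k / (\<sigma> j + \<sigma> k)\<^sup>2)"
      using p by (simp add: field_simps power2_eq_square)
  qed
  finally show "(LINT \<xi>|lborel. (1 + (norm \<xi>)\<^sup>2) * (norm (g \<xi>))\<^sup>2)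
      \<le> 4 * pi * (\<Sum>j<n. \<Sum>k<n. \<sigma> j * \<sigma> k / (\<sigma> j + \<sigma> k)\<^sup>2)" .
qed

lemma heat_M_ge:
  assumes t: "0 < t" and n: "0 < n" and small: "\<And>k. k < n \<Longrightarrow> t * 2 ^ k \<le> 1"
  shows "ennreal (real n / 4 / sqrt (12 * pi * real n)) \<le> heat_M t"
proof -
  define \<sigma> where "\<sigma> = (\<lambda>k::nat. t * 2 ^ k)"
  have \<sigma>: "\<sigma> k > 0" "\<sigma> k \<ge> t" for k using t by (auto simp: \<sigma>_def)
  \<comment> \<open>The factor \<open>1 / 2\<close> is chosen because the transform of
    \<open>gauss (1 / (4 * \<sigma> k))\<close> is \<open>2 * \<sigma> k\<close> times
    \<open>gauss (\<sigma> k)\<close>; thus \<open>f\<close> has transform \<open>g\<close>.\<close>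
  define f where "f = (\<lambda>x. \<Sum>k<n. complex_of_real (1 / 2) * gauss (1 / (4 * \<sigma> k)) x)"
  define g where "g = (\<lambda>\<xi>. \<Sum>k<n. complex_of_real (\<sigma> k) * gauss (\<sigma> k) \<xi>)"
  \<comment> \<open>The heat multiplier shifts every exponent of \<open>g\<close> by
    \<open>t\<close>; \<open>u\<close> below is the explicit inverse transform of
    \<open>h\<close>.\<close>
  define h where "h = (\<lambda>\<xi>. \<Sum>k<n. complex_of_real (\<sigma> k) * gauss (\<sigma> k + t) \<xi>)"
  define u where "u = (\<lambda>x. \<Sum>k<n. complex_of_real (\<sigma> k) * (complex_of_real (1 / (2 * (\<sigma> k + t))) * gauss (1 / (4 * (\<sigma> k + t))) x))"
  have f_s: "f \<in> schwartz" unfolding f_def by (rule gauss_sum_schwartz) (auto simp: \<sigma>)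
  have h_s: "h \<in> schwartz" unfolding h_def by (rule gauss_sum_schwartz) (use \<sigma> t in \<open>auto intro: add_pos_pos\<close>)
  have ftf: "ft (- 1) f = g"
    unfolding f_def g_def
    by (subst ft_gauss_sum) (use \<sigma> in \<open>auto simp: fun_eq_iff intro!: sum.cong\<close>)
  have fth: "ft 1 h = u"
    unfolding h_def u_def by (subst ft_gauss_sum) (use \<sigma> t in \<open>auto intro: add_pos_pos\<close>)
  have F: "fourier f \<in> L2" "AE \<xi> in lborel. fourier f \<xi> = g \<xi>"
    using L2_extension_ft[OF f_s AE_I2, of f "- 1"] by (simp_all add: fourier_def fourier_integral_eq_ft ftf)
  have "AE \<xi> in lborel. complex_of_real (exp (- t * (norm \<xi>)\<^sup>2)) * fourier f \<xi> = h \<xi>"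
    using F(2)
  proof eventually_elim
    case (elim \<xi>)
    have "complex_of_real (exp (- t * (norm \<xi>)\<^sup>2)) * gauss a \<xi> = gauss (a + t) \<xi>" for a
      unfolding gauss_def of_real_mult[symmetric] exp_add[symmetric] by (simp add: algebra_simps)
    then show ?case unfolding elim g_def h_def sum_distrib_left
      by (simp only: mult.left_commute)
  qed
  then have heat: "AE x in lborel. heat t f x = u x"
    using L2_extension_ft(2)[OF h_s _, of _ 1] by (simp add: heat_def inv_fourier_def inv_fourier_integral_eq_ft fth)
  have cont: "continuous_on UNIV u"
    unfolding u_def gauss_def by (intro continuous_intros)
  \<comment> \<open>At the origin all Gaussians equal 1, and each scale contributes
    \<open>\<sigma> k / (2 * (\<sigma> k + t)) \<ge> 1 / 4\<close> because
    \<open>\<sigma> k \<ge> t\<close>.\<close>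
  have u0: "real n / 4 \<le> norm (u 0)"
  proof -
    have "real n / 4 = (\<Sum>k<n. 1 / 4 :: real)" by simp
    also have "\<dots> \<le> (\<Sum>k<n. \<sigma> k * (1 / (2 * (\<sigma> k + t))))"
    proof (rule sum_mono)
      fix k
      show "1 / 4 \<le> \<sigma> k * (1 / (2 * (\<sigma> k + t)))" using \<sigma>[of k] t by (simp add: field_simps)
    qed
    also have "\<dots> \<le> norm (complex_of_real (\<Sum>k<n. \<sigma> k * (1 / (2 * (\<sigma> k + t)))))"
      unfolding norm_of_real by (rule abs_ge_self)
    also have "complex_of_real (\<Sum>k<n. \<sigma> k * (1 / (2 * (\<sigma> k + t)))) = u 0"
      by (simp add: u_def gauss_def)
    finally show ?thesis .
  qed
  have Linf: "ennreal (real n / 4) \<le> Linf_norm (heat t f)"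
    using ennreal_leI[OF u0] Linf_norm_ge[OF heat cont, of 0] by (rule order_trans)
  have "\<sigma> k \<le> 1" if "k < n" for k using small[OF that] by (simp add: \<sigma>_def)
  note w = gauss_sum_weighted_L2[of n \<sigma>, OF \<sigma>(1) this]
  have gw: "integrable lborel (\<lambda>\<xi>. (1 + (norm \<xi>)\<^sup>2) * (norm (g \<xi>))\<^sup>2)"
    "(LINT \<xi>|lborel. (1 + (norm \<xi>)\<^sup>2) * (norm (g \<xi>))\<^sup>2)
      \<le> 4 * pi * (\<Sum>j<n. \<Sum>k<n. \<sigma> j * \<sigma> k / (\<sigma> j + \<sigma> k)\<^sup>2)"
    unfolding g_def using w by - assumption+
  have Fm[measurable]: "fourier f \<in> borel_measurable borel" using F(1) by (simp add: L2_def)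
  have gm[measurable]: "g \<in> borel_measurable borel" unfolding g_def gauss_def by measurable
  have ae: "AE \<xi> in lborel. (1 + (norm \<xi>)\<^sup>2) * (norm (fourier f \<xi>))\<^sup>2 = (1 + (norm \<xi>)\<^sup>2) * (norm (g \<xi>))\<^sup>2"
    using F(2) by eventually_elim simp
  have "integrable lborel (\<lambda>\<xi>. (1 + (norm \<xi>)\<^sup>2) * (norm (fourier f \<xi>))\<^sup>2)"
    using gw(1) by (subst integrable_cong_AE[OF _ _ ae]) auto
  then have fH1: "f \<in> H1" using schwartz_L2[OF f_s] by (simp add: H1_def)
  have "(LINT \<xi>|lborel. (1 + (norm \<xi>)\<^sup>2) * (norm (fourier f \<xi>))\<^sup>2) = (LINT \<xi>|lborel. (1 + (norm \<xi>)\<^sup>2) * (norm (g \<xi>))\<^sup>2)"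
    by (rule integral_cong_AE[OF _ _ ae]) measurable
  also have "\<dots> \<le> 4 * pi * (\<Sum>j<n. \<Sum>k<n. \<sigma> j * \<sigma> k / (\<sigma> j + \<sigma> k)\<^sup>2)"
    by (rule gw(2))
  also have "\<dots> \<le> 4 * pi * (3 * real n)"
    unfolding \<sigma>_def by (intro mult_left_mono sum_dyadic_interaction t) simp
  finally have norm_le: "H1_norm f \<le> sqrt (12 * pi * real n)" unfolding H1_norm_def by simp
  have norm_ge: "0 \<le> H1_norm f" unfolding H1_norm_def by simp
  \<comment> \<open>By continuity, vanishing almost everywhere would force \<open>f 0 = 0\<close>,
    whereas this value is \<open>n / 2\<close>.\<close>
  have nz: "\<not> (AE x in lborel. f x = 0)"
  proof
    assume "AE x in lborel. f x = 0"
    then have "AE x in lborel. f x \<in> {0}" by simp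
    then have "f 0 \<in> {0}" by (rule AE_lborel_continuous_closed) (auto intro: schwartz_continuous f_s)
    then show False using n by (simp add: f_def gauss_def)
  qed
  have "ennreal (real n / 4 / sqrt (12 * pi * real n)) \<le> Linf_norm (heat t f) / ennreal (H1_norm f)"
    by (rule ennreal_divide_ge[OF Linf _ norm_ge norm_le]) (use n in auto)
  also have "\<dots> \<le> heat_M t"
    unfolding heat_M_def by (rule SUP_upper) (use fH1 nz in simp)
  finally show ?thesis .
qed

section \<open>Choice of the number of scales and conclusion\<close>

lemma number_of_scales:
  fixes t :: real
  assumes t: "0 < t" "t < 1 / exp 1"
  obtains n :: nat where "0 < n" "\<And>k. k < n \<Longrightarrow> t * 2 ^ k \<le> 1" "ln (exp 1 + 1 / t) \<le> 2 * real n"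
proof -
  have e: "exp 1 < 1 / t" using t by (simp add: field_simps)
  have "ln (exp 1) < ln (1 / t)" using e t by (subst ln_less_cancel_iff) auto
  then have l: "1 < ln (1 / t)" by simp
  \<comment> \<open>This is the number of \<open>k\<close> with \<open>t * 2 ^ k < 1\<close>; it
    dominates \<open>ln (1 / t)\<close> because \<open>ln 2 \<le> 1\<close>.\<close>
  define n where "n = nat \<lceil>log 2 (1 / t)\<rceil>"
  have ln2: "ln 2 \<le> (1::real)" "0 < ln (2::real)" using ln_le_minus_one[of "2::real"] by auto
  have "ln (1 / t) * ln 2 \<le> ln (1 / t) * 1" using l ln2 by (intro mult_left_mono) auto
  then have log: "ln (1 / t) \<le> log 2 (1 / t)" using ln2 by (simp add: log_def pos_le_divide_eq)
  have nl: "log 2 (1 / t) \<le> real n" unfolding n_def by (rule real_nat_ceiling_ge)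
  have n: "ln (1 / t) \<le> real n" using log nl by linarith
  show thesis
  proof (rule that[of n])
    show "0 < n" using n l by (cases n) auto
    fix k assume "k < n"
    then have "real k < log 2 (1 / t)" unfolding n_def by linarith
    then have "2 powr real k < 2 powr log 2 (1 / t)" by simp
    then have "2 ^ k < 1 / t" using t by (simp add: powr_realpow)
    then show "t * 2 ^ k \<le> 1" using t by (simp add: field_simps)
  next
    \<comment> \<open>The restriction \<open>t < 1 / exp 1\<close> gives
      \<open>exp 1 < 1 / t\<close>; it also gives \<open>ln (1 / t) > 1\<close>, which lets the
      extra \<open>ln 2\<close> be absorbed by a second \<open>n\<close>.\<close>
    have "ln (exp 1 + 1 / t) \<le> ln (2 * (1 / t))"
      using e t by (subst ln_le_cancel_iff) (auto intro: add_pos_pos)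
    also have "\<dots> = ln 2 + ln (1 / t)" using t by (subst ln_mult) auto
    also have "\<dots> \<le> 2 * real n" using ln2 l n by linarith
    finally show "ln (exp 1 + 1 / t) \<le> 2 * real n" .
  qed
qed

theorem theorem1p2:
  "(INF t \<in> {0<..<1 / exp 1}. heat_M t / ennreal (sqrt (ln (exp 1 + 1 / t))))
     \<ge> ennreal (1 / (2 * sqrt (2 * pi) * (exp 1)\<^sup>2))"
proof (rule INF_greatest)
  fix t :: real assume "t \<in> {0<..<1 / exp 1}"
  then have t: "0 < t" "t < 1 / exp 1" by auto
  obtain n where n: "0 < n" "\<And>k. k < n \<Longrightarrow> t * 2 ^ k \<le> 1" "ln (exp 1 + 1 / t) \<le> 2 * real n"
    using number_of_scales[OF t] by blast
  define L where "L = ln (exp 1 + 1 / t)"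
  have "exp 1 + 1 / t > 1" using t exp_ge_add_one_self[of 1] zero_less_divide_1_iff[of t] by linarith
  then have L: "0 < L" by (simp add: L_def)
  let ?e = "exp 1 :: real"
  let ?v = "real n / 4 / sqrt (12 * pi * real n)"
  have v: "0 < ?v" using n by simp
  \<comment> \<open>After squaring, the claim reads
    \<open>1 / (8 * pi * ?e ^ 4) \<le> real n / (192 * pi * L)\<close>, that is
    \<open>24 * L \<le> ?e ^ 4 * real n\<close>. As \<open>L \<le> 2 * real n\<close>, it is enough
    that \<open>?e ^ 4 \<ge> 48\<close>.\<close>
  have "1 / (2 * sqrt (2 * pi) * ?e\<^sup>2) \<le> ?v / sqrt L"
  proof (rule power2_le_imp_le)
    \<comment> \<open>The bound 2.7 suffices, since its fourth power exceeds 53.\<close>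
    have "27 / 10 \<le> ?e" using abs_le_D2[OF e_approx_32] by simp
    then have "(27 / 10) ^ 4 \<le> ?e ^ 4" by (intro power_mono) auto
    then have e4: "48 \<le> ?e ^ 4" by (simp add: power_divide)
    have "24 * L \<le> 48 * real n" using n(3) by (simp add: L_def)
    also have "\<dots> \<le> ?e ^ 4 * real n" using e4 by (intro mult_right_mono) auto
    finally have *: "24 * L \<le> ?e ^ 4 * real n" .
    have "(1 / (2 * sqrt (2 * pi) * ?e\<^sup>2))\<^sup>2 = 1 / (8 * pi * ?e ^ 4)"
      by (simp add: power_divide power_mult_distrib power_mult[symmetric])
    also have "\<dots> \<le> real n / (192 * pi * L)"
      using * L by (simp add: field_simps)
    also have "\<dots> = (?v / sqrt L)\<^sup>2"
      using L n by (simp add: power_divide power_mult_distrib power2_eq_square field_simps)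
    finally show "(1 / (2 * sqrt (2 * pi) * ?e\<^sup>2))\<^sup>2 \<le> (?v / sqrt L)\<^sup>2" .
    show "0 \<le> ?v / sqrt L" using v L by simp
  qed
  then have "ennreal (1 / (2 * sqrt (2 * pi) * ?e\<^sup>2)) \<le> ennreal (?v / sqrt L)" by (rule ennreal_leI)
  also have "\<dots> \<le> heat_M t / ennreal (sqrt L)"
    by (rule ennreal_divide_ge[OF heat_M_ge[OF t(1) n(1,2)] v]) (use L in auto)
  finally show "ennreal (1 / (2 * sqrt (2 * pi) * (exp 1)\<^sup>2)) \<le> heat_M t / ennreal (sqrt (ln (exp 1 + 1 / t)))"
    unfolding L_def .
qed

end
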